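(* Let $n\ge 1$ and let $\xi_1,\dots,\xi_n$ be independent random variables with values in a measurable space $(\mathbb{X},\mathcal{X})$, all having the same distribution $\mathbb{P}$. Let $\mathcal{C}\subset\mathcal{X}$ be a countable family of measurable sets which is a VC class of index $d\ge 1$. Put $$Z=\sup_{C\in\mathcal{C}}\left|\sum_{i=1}^n\left(\mathbf{1}_C(\xi_i)-\mathbb{P}(C)\right)\right|.$$ Then for all real numbers $\eta>0$ and $x>0$, $$\Pr\left(Z\ \ge\ 1015(1+\eta)\,d\left(1+\sqrt{1+\frac{2n}{1015\,d}}\right)+2\sqrt{nx}+\left(2.5+32\eta^{-1}\right)x\right)\ \le\ 2e^{-x}.$$
   Context: $\mathbf{1}_C$ denotes the indicator function of $C$. A class $\mathcal{C}$ of subsets of $\mathbb{X}$ shatters a finite set $A\subset\mathbb{X}$ if for every subset $B\subset A$ there is $C\in\mathcal{C}$ with $B=A\cap C$. $\mathcal{C}$ is a VC (Vapnik--Chervonenkis) class of index $d$ if $d$ is the largest (finite) number such that $\mathcal{C}$ shatters at least one set of cardinality $d$. *)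

theory Defs
  imports "HOL-Probability.Probability"
begin

definition shatters :: "'b set set \<Rightarrow> 'b set \<Rightarrow> bool" where
  "shatters \<C> A \<longleftrightarrow> finite A \<and> (\<forall>B\<subseteq>A. \<exists>C\<in>\<C>. B = A \<inter> C)"

definition VC_class :: "'b set \<Rightarrow> 'b set set \<Rightarrow> nat \<Rightarrow> bool" where
  "VC_class S \<C> d \<longleftrightarrow>
     (\<exists>A\<subseteq>S. shatters \<C> A \<and> card A = d) \<and>
     (\<forall>k. (\<exists>A\<subseteq>S. shatters \<C> A \<and> card A = k) \<longrightarrow> k \<le> d)"

end

theory Submission
  imports Defs
begin

text \<open>
  The proof combines a chaining bound for the expected deviation with concentration around the
  mean. Both are carried out after symmetrization, where the only randomness left is a
  vector of $n$ independent signs.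

  Comparing the sample with an independent copy (a ghost sample) bounds the exponential moment
  of $Z$ by that of $\sup_C |\sum_i (1_C(\<xi>_i) - 1_C(\<xi>'_i))|$ (lemma \<open>symmetrization\<close>).
  Exchanging $\<xi>_i$ and $\<xi>'_i$ does not change the joint law, so the differences may be multiplied by
  random signs, and it suffices to bound the average over the signs for every fixed choice of the
  $2 n$ points (lemma \<open>emp_dev_mgf_le\<close>). There only the traces of the class on these
  points matter; they form a finite family that shatters no set of more than $d$ indices.

  For such a family, flipping one sign changes the supremum $S$ by at most 2, so
  its exponential moment is at most $\exp (c \, E S + c^2 n / 2)$ (lemma
  \<open>bounded_differences_mgf\<close>). The mean is estimated by chaining (lemma \<open>rad_sup_mean_le\<close>): it is at
  most $10 \sqrt{8 n d} < 30 \sqrt{n d}$. No factor $\ln n$ is lost because the number of traces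
  whose mutual distances are at least a fraction $\<rho>$ of the $2 n$ points is at most
  $(7 / \<rho>)^{2 d}$, independently of $n$ (lemma \<open>ln_card_packing_le\<close>). This bound follows
  from the Sauer--Shelah lemma (lemma \<open>sauer_shelah\<close>) applied to a random subsample that still tells the traces apart.

  In the claimed inequality, the first summand of the threshold is at least 
  $1015 \, d \, \sqrt{2 n / (1015 d)} = \sqrt{2030 \, n d}$. It therefore
  dominates the mean, and Chernoff's bound at distance $2 \sqrt{n x}$ from the mean gives probability
  at most $e^{- 2 x} \le 2 e^{- x}$.
\<close>

section \<open>Averages over random signs\<close>

text \<open>
  A vector of $n$ random signs is encoded as the uniformly chosen set $A$ of the indices that carry
  the sign $+1$. The average over signs is then a finite sum over a power set, and the standard
  induction on finite sets splits off one sign at a time.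
\<close>

definition sign_of :: "nat set \<Rightarrow> nat \<Rightarrow> real" where
  "sign_of A i = (if i \<in> A then 1 else - 1)"

definition rad_sum :: "nat set \<Rightarrow> (nat \<Rightarrow> real) \<Rightarrow> nat set \<Rightarrow> real" where
  "rad_sum I a A = (\<Sum>i\<in>I. sign_of A i * a i)"

definition rad_mean :: "nat set \<Rightarrow> (nat set \<Rightarrow> real) \<Rightarrow> real" where
  "rad_mean I f = (\<Sum>A\<in>Pow I. f A) / 2 ^ card I"

lemma rad_mean_insert:
  assumes "finite I" "i \<notin> I"
  shows "rad_mean (insert i I) f = (rad_mean I (\<lambda>A. f (insert i A)) + rad_mean I f) / 2"
proof -
  have inj: "inj_on (insert i) (Pow I)"
    using assms(2) by (auto simp: inj_on_def)
  have "(\<Sum>A\<in>Pow (insert i I). f A) = (\<Sum>A\<in>Pow I. f A) + (\<Sum>A\<in>insert i ` Pow I. f A)"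
    unfolding Pow_insert using assms by (intro sum.union_disjoint) auto
  also have "(\<Sum>A\<in>insert i ` Pow I. f A) = (\<Sum>A\<in>Pow I. f (insert i A))"
    using inj by (simp add: sum.reindex)
  finally show ?thesis
    using assms by (simp add: rad_mean_def field_simps)
qed

lemma rad_mean_empty [simp]: "rad_mean {} f = f {}"
  by (simp add: rad_mean_def)

lemma rad_mean_mono:
  assumes "\<And>A. A \<subseteq> I \<Longrightarrow> f A \<le> g A"
  shows "rad_mean I f \<le> rad_mean I g"
  unfolding rad_mean_def using assms by (intro divide_right_mono sum_mono) auto

lemma rad_mean_cong:
  assumes "\<And>A. A \<subseteq> I \<Longrightarrow> f A = g A"
  shows "rad_mean I f = rad_mean I g"
  unfolding rad_mean_def using assms by (intro arg_cong2[of _ _ _ _ "(/)"] sum.cong) auto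

lemma rad_mean_add: "rad_mean I (\<lambda>A. f A + g A) = rad_mean I f + rad_mean I g"
  by (simp add: rad_mean_def sum.distrib add_divide_distrib)

lemma rad_mean_cmult: "rad_mean I (\<lambda>A. c * f A) = c * rad_mean I f"
  by (simp add: rad_mean_def sum_distrib_left)

lemma rad_mean_sum: "rad_mean I (\<lambda>A. \<Sum>t\<in>G. f t A) = (\<Sum>t\<in>G. rad_mean I (f t))"
  by (simp add: rad_mean_def sum_divide_distrib sum.swap[of _ G])

lemma rad_mean_const: "finite I \<Longrightarrow> rad_mean I (\<lambda>_. c) = c"
  by (simp add: rad_mean_def card_Pow)

text \<open>
  The logarithm of the left side has derivative $\tanh$, and $\tanh t \le t$ for $t \ge 0$. This is
  the only inequality about exponentials behind the sub-Gaussian bounds below.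
\<close>

lemma cosh_le_exp_half_square: "cosh (x::real) \<le> exp (x\<^sup>2 / 2)"
proof -
  have *: "cosh y \<le> exp (y\<^sup>2 / 2)" if "0 \<le> y" for y :: real
  proof -
    have "(\<lambda>y. y\<^sup>2/2 - ln (cosh y)) 0 \<le> (\<lambda>y. y\<^sup>2/2 - ln (cosh y)) y"
    proof (rule DERIV_nonneg_imp_nondecreasing[OF that])
      fix t :: real assume t: "0 \<le> t" "t \<le> y"
      have "sinh s \<le> s * cosh s" if "0 \<le> s" for s :: real
      proof -
        have "(\<lambda>s. s * cosh s - sinh s) 0 \<le> (\<lambda>s. s * cosh s - sinh s) s"
        proof (rule DERIV_nonneg_imp_nondecreasing[OF that])
          fix r :: real assume "0 \<le> r" "r \<le> s"
          then show "\<exists>z. ((\<lambda>s. s * cosh s - sinh s) has_real_derivative z) (at r) \<and> 0 \<le> z"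
            by (intro exI[of _ "r * sinh r"]) (auto intro!: derivative_eq_intros)
        qed
        then show ?thesis by simp
      qed
      then have "0 \<le> t - sinh t / cosh t"
        using t by (simp add: field_simps)
      moreover have "((\<lambda>y. y\<^sup>2/2 - ln (cosh y)) has_real_derivative t - sinh t / cosh t) (at t)"
        by (auto intro!: derivative_eq_intros)
      ultimately show "\<exists>z. ((\<lambda>y. y\<^sup>2/2 - ln (cosh y)) has_real_derivative z) (at t) \<and> 0 \<le> z"
        by blast
    qed
    then have "ln (cosh y) \<le> y\<^sup>2 / 2" by simp
    then show ?thesis
      by (metis cosh_real_pos exp_le_cancel_iff exp_ln)
  qed
  show ?thesis
    using *[of "\<bar>x\<bar>"] by (cases "0 \<le> x") (auto simp: abs_if)
qed

text \<open>
  Averaging over one sign: factoring out the exponential of the mean leaves a hyperbolic cosine of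
  half the difference.
\<close>

lemma two_point_mgf:
  fixes u v c :: real
  assumes "\<bar>u - v\<bar> \<le> 2"
  shows "(exp (c * u) + exp (c * v)) / 2 \<le> exp (c * ((u + v) / 2) + c\<^sup>2 / 2)"
proof -
  define h where "h = (u - v) / 2"
  have h: "\<bar>h\<bar> \<le> 1" using assms by (simp add: h_def)
  have uv: "c * u = c * ((u + v) / 2) + c * h" "c * v = c * ((u + v) / 2) + - (c * h)"
    by (simp_all add: h_def field_simps)
  have "(exp (c * u) + exp (c * v)) / 2 = exp (c * ((u + v) / 2)) * cosh (c * h)"
    unfolding uv(1) uv(2) exp_add cosh_field_def by (simp add: field_simps)
  also have "\<dots> \<le> exp (c * ((u + v) / 2)) * exp (c\<^sup>2 / 2)"
  proof (intro mult_left_mono order_trans[OF cosh_le_exp_half_square])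
    have "(c * h)\<^sup>2 \<le> c\<^sup>2"
      using h by (simp add: power_mult_distrib mult_left_le abs_square_le_1)
    then show "exp ((c * h)\<^sup>2 / 2) \<le> exp (c\<^sup>2 / 2)" by simp
  qed simp
  finally show ?thesis by (simp add: exp_add)
qed

text \<open>
  McDiarmid's inequality on the cube. Averaging out one sign with the two-point bound costs a factor
  $\exp (c^2 / 2)$, and what remains is again a function with differences at most 2, so induction on
  the number of signs applies. The mean of \<open>f\<close> stays in the bound; it is estimated separately, by
  chaining.
\<close>

lemma bounded_differences_mgf:
  assumes "finite I"
    and "\<And>i A. i \<in> I \<Longrightarrow> A \<subseteq> I \<Longrightarrow> i \<notin> A \<Longrightarrow> \<bar>f (insert i A) - f A\<bar> \<le> 2"
  shows "rad_mean I (\<lambda>A. exp (c * f A)) \<le> exp (c * rad_mean I f + c\<^sup>2 * card I / 2)"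
  using assms
proof (induction I arbitrary: f rule: finite_induct)
  case empty
  then show ?case by simp
next
  case (insert i I)
  let ?g = "\<lambda>A. (f (insert i A) + f A) / 2"
  have "rad_mean (insert i I) (\<lambda>A. exp (c * f A))
      = rad_mean I (\<lambda>A. (exp (c * f (insert i A)) + exp (c * f A)) / 2)"
    unfolding rad_mean_insert[OF insert.hyps]
    by (simp add: rad_mean_def sum.distrib field_simps flip: sum_divide_distrib)
  also have "\<dots> \<le> rad_mean I (\<lambda>A. exp (c\<^sup>2 / 2) * exp (c * ?g A))"
  proof (rule rad_mean_mono)
    fix A assume "A \<subseteq> I"
    then have "\<bar>f (insert i A) - f A\<bar> \<le> 2"
      using insert.hyps by (intro insert.prems) auto
    from two_point_mgf[OF this, of c]
    show "(exp (c * f (insert i A)) + exp (c * f A)) / 2 \<le> exp (c\<^sup>2 / 2) * exp (c * ?g A)"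
      by (simp add: exp_add mult.commute)
  qed
  also have "\<dots> = exp (c\<^sup>2 / 2) * rad_mean I (\<lambda>A. exp (c * ?g A))"
    by (rule rad_mean_cmult)
  also have "\<dots> \<le> exp (c\<^sup>2 / 2) * exp (c * rad_mean I ?g + c\<^sup>2 * card I / 2)"
  proof (intro mult_left_mono insert.IH)
    fix j A assume j: "j \<in> I" "A \<subseteq> I" "j \<notin> A"
    have "\<bar>f (insert j A) - f A\<bar> \<le> 2" 
      using j by (intro insert.prems) auto
    moreover have "\<bar>f (insert j (insert i A)) - f (insert i A)\<bar> \<le> 2"
      using j insert.hyps by (intro insert.prems) auto
    ultimately show "\<bar>?g (insert j A) - ?g A\<bar> \<le> 2"
      by (simp add: insert_commute abs_le_iff field_simps)
  qed simp
  also have "rad_mean I ?g = rad_mean (insert i I) f"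
    unfolding rad_mean_insert[OF insert.hyps]
    by (simp add: rad_mean_def sum.distrib field_simps flip: sum_divide_distrib)
  finally show ?case
    using insert.hyps by (simp add: field_simps flip: exp_add)
qed

lemma rad_sum_mgf:
  assumes "finite I"
  shows "rad_mean I (\<lambda>A. exp (rad_sum I a A)) \<le> exp ((\<Sum>i\<in>I. (a i)\<^sup>2) / 2)"
  using assms
proof (induction I rule: finite_induct)
  case empty
  then show ?case by (simp add: rad_sum_def)
next
  case (insert i I)
  have 1: "exp (rad_sum (insert i I) a (insert i A)) = exp (a i) * exp (rad_sum I a A)"
    if "A \<subseteq> I" for A
  proof -
    have "(\<Sum>k\<in>I. sign_of (insert i A) k * a k) = (\<Sum>k\<in>I. sign_of A k * a k)"
      using insert.hyps by (intro sum.cong) (auto simp: sign_of_def)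
    then show ?thesis
      using insert.hyps by (simp add: rad_sum_def exp_add sign_of_def)
  qed
  have 2: "exp (rad_sum (insert i I) a A) = exp (- a i) * exp (rad_sum I a A)"
    if "A \<subseteq> I" for A
    using insert.hyps that by (auto simp add: rad_sum_def sign_of_def simp flip: exp_add)
  have "rad_mean (insert i I) (\<lambda>A. exp (rad_sum (insert i I) a A))
     = (rad_mean I (\<lambda>A. exp (a i) * exp (rad_sum I a A))
        + rad_mean I (\<lambda>A. exp (- a i) * exp (rad_sum I a A))) / 2"
    unfolding rad_mean_insert[OF insert.hyps]
    using 1 2 by (auto intro!: arg_cong2[of _ _ _ _ "(+)"] rad_mean_cong)
  also have "\<dots> = cosh (a i) * rad_mean I (\<lambda>A. exp (rad_sum I a A))"
    unfolding rad_mean_cmult cosh_field_def by (simp add: field_simps)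
  also have "\<dots> \<le> exp ((a i)\<^sup>2 / 2) * exp ((\<Sum>i\<in>I. (a i)\<^sup>2) / 2)"
    by (intro mult_mono cosh_le_exp_half_square insert.IH)
       (auto simp: rad_mean_def intro!: divide_nonneg_nonneg sum_nonneg)
  finally show ?case
    using insert.hyps by (simp add: add_divide_distrib flip: exp_add)
qed

text \<open>
  Up to scaling, the mean of the maximum of $N$ sub-Gaussian variables and their negatives is at most
  the logarithm of the sum of the $2 N$ exponential moments. Two such maxima meet in the chaining argument: over the
  increments along one link, and over the coarsest net. The set of coefficient vectors enters only
  through an upper bound \<open>L\<close> of $\ln (2 N)$.
\<close>

lemma rad_mean_Max_abs_rad_sum_le:
  assumes I: "finite I" and G: "finite G" "G \<noteq> {}"
    and v: "\<And>T. T \<in> G \<Longrightarrow> (\<Sum>i\<in>I. (a T i)\<^sup>2) \<le> v" "0 < v"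
    and N: "ln (2 * card G) \<le> L"
  shows "rad_mean I (\<lambda>A. MAX T\<in>G. \<bar>rad_sum I (a T) A\<bar>) \<le> sqrt (2 * v * L)"
proof -
  have "0 < card G" using G by auto
  then have "0 < ln (2 * card G)" by (intro ln_gt_zero) auto
  then have L: "0 < L" using N by linarith
  \<comment> \<open>The optimal scale: it makes each exponential moment at most \<open>exp L\<close>, since
    \<open>c\<^sup>2 * v / 2 = L\<close>.\<close>
  define c where "c = sqrt (2 * L / v)"
  have c: "0 < c" and c2: "c\<^sup>2 = 2 * L / v"
    using L v by (auto simp: c_def)
  define B where "B = exp (2 * L)"
  have scale: "c * rad_sum I b A = rad_sum I (\<lambda>i. c * b i) A" for b A
    by (simp add: rad_sum_def sum_distrib_left mult_ac)
  have mgf: "rad_mean I (\<lambda>A. exp (c * rad_sum I b A)) \<le> exp L"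
    if "(\<Sum>i\<in>I. (b i)\<^sup>2) \<le> v" for b
  proof -
    have "rad_mean I (\<lambda>A. exp (c * rad_sum I b A)) \<le> exp (c\<^sup>2 * (\<Sum>i\<in>I. (b i)\<^sup>2) / 2)"
      unfolding scale using rad_sum_mgf[OF I, of "\<lambda>i. c * b i"]
      by (simp add: power_mult_distrib sum_distrib_left)
    also have "\<dots> \<le> exp (c\<^sup>2 * v / 2)" using that by (simp add: mult_left_mono)
    also have "c\<^sup>2 * v / 2 = L" using v by (simp add: c2)
    finally show ?thesis .
  qed
  \<comment> \<open>Instead of Jensen's inequality, the tangent of the exponential at \<open>2 * L\<close> bounds the maximum
    pointwise by something whose mean is a sum of exponential moments.\<close>
  have pt: "c * (MAX T\<in>G. \<bar>rad_sum I (a T) A\<bar>)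
     \<le> (2 * L - 1) + (1 / B) * (\<Sum>T\<in>G. exp (c * rad_sum I (a T) A) + exp (c * rad_sum I (\<lambda>i. - a T i) A))" 
    for A
  proof -
    have "(MAX T\<in>G. \<bar>rad_sum I (a T) A\<bar>) \<in> (\<lambda>T. \<bar>rad_sum I (a T) A\<bar>) ` G"
      using G by (intro Max_in) auto
    then obtain T where T: "T \<in> G" "(MAX T\<in>G. \<bar>rad_sum I (a T) A\<bar>) = \<bar>rad_sum I (a T) A\<bar>"
      by blast
    let ?y = "c * \<bar>rad_sum I (a T) A\<bar>"
    have neg: "rad_sum I (\<lambda>i. - a T i) A = - rad_sum I (a T) A" for T
      by (simp add: rad_sum_def sum_negf)
    have "?y - 2 * L + 1 \<le> exp (?y - 2 * L)" 
      using exp_ge_add_one_self[of "?y - 2 * L"] by linarith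
    also have "\<dots> = exp ?y / B" by (simp add: B_def exp_diff)
    also have "exp ?y \<le> exp (c * rad_sum I (a T) A) + exp (c * rad_sum I (\<lambda>i. - a T i) A)"
      unfolding neg by (simp add: abs_if)
    also have "\<dots> \<le> (\<Sum>T\<in>G. exp (c * rad_sum I (a T) A) + exp (c * rad_sum I (\<lambda>i. - a T i) A))"
      using T G by (intro member_le_sum) auto
    finally show ?thesis 
      unfolding T(2) by (simp add: B_def divide_right_mono)
  qed
  have "c * rad_mean I (\<lambda>A. MAX T\<in>G. \<bar>rad_sum I (a T) A\<bar>)
     \<le> rad_mean I (\<lambda>A. (2 * L - 1) + (1 / B) * (\<Sum>T\<in>G. exp (c * rad_sum I (a T) A) + exp (c * rad_sum I (\<lambda>i. - a T i) A)))"
    unfolding rad_mean_cmult[symmetric] by (intro rad_mean_mono pt)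
  also have "\<dots> = (2 * L - 1) + (1 / B) * (\<Sum>T\<in>G. rad_mean I (\<lambda>A. exp (c * rad_sum I (a T) A)) 
       + rad_mean I (\<lambda>A. exp (c * rad_sum I (\<lambda>i. - a T i) A)))"
    by (simp only: rad_mean_add rad_mean_cmult rad_mean_sum rad_mean_const[OF I])
  also have "\<dots> \<le> (2 * L - 1) + (1 / B) * (\<Sum>T\<in>G. exp L + exp L)"
    using v by (intro add_left_mono mult_left_mono sum_mono add_mono mgf) (auto simp: B_def)
  also have "(1 / B) * (\<Sum>T\<in>G. exp L + exp L) = exp (ln (2 * card G)) / exp L"
    using \<open>0 < card G\<close> exp_add[of L L] by (simp add: B_def)
  also have "(2 * L - 1) + exp (ln (2 * card G)) / exp L \<le> 2 * L"
    using N by (simp del: exp_ln)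
  finally have "rad_mean I (\<lambda>A. MAX T\<in>G. \<bar>rad_sum I (a T) A\<bar>) \<le> 2 * L / c"
    using c by (simp add: field_simps)
  also have "\<dots> = sqrt (2 * v * L)"
  proof (rule real_sqrt_unique[symmetric])
    show "(2 * L / c)\<^sup>2 = 2 * v * L"
      using L v unfolding power_divide c2 by (simp add: field_simps power2_eq_square)
  qed (use L c in auto)
  finally show ?thesis .
qed

section \<open>Packing numbers of a VC class\<close>

lemma shatters_mono: "shatters F A \<Longrightarrow> F \<subseteq> F' \<Longrightarrow> shatters F' A"
  unfolding shatters_def by blast

text \<open>
  Pajor's form of the Sauer--Shelah lemma, by induction on the ground set. Deleting a point \<open>u\<close> merges
  those pairs of members of \<open>F\<close> that differ exactly in \<open>u\<close>; so the cardinality of \<open>F\<close> is that of its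
  image plus the number of merged pairs. Sets shattered by the image are shattered by \<open>F\<close> and avoid
  \<open>u\<close>; sets shattered by the merged pairs stay shattered by \<open>F\<close> after \<open>u\<close> is added.
\<close>

lemma card_le_card_shattered:
  assumes "finite U" "F \<subseteq> Pow U"
  shows "card F \<le> card {A. A \<subseteq> U \<and> shatters F A}"
  using assms
proof (induction U arbitrary: F rule: finite_induct)
  case empty
  then consider "F = {}" | "F = {{}}" by auto
  then show ?case
  proof cases
    case 2
    have "{A. A \<subseteq> {} \<and> shatters F A} = {{}}"
      unfolding 2 by (auto simp: shatters_def)
    then show ?thesis by (simp add: 2)
  qed simp
next
  case (insert u U)
  let ?F0 = "(\<lambda>C. C - {u}) ` F"
  let ?F1 = "{C. u \<notin> C \<and> C \<in> F \<and> insert u C \<in> F}"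
  have finF: "finite F"
    using insert.prems insert.hyps finite_subset[of F "Pow (insert u U)"] by simp
  define Fn where "Fn = {C\<in>F. u \<notin> C}"
  define Fy where "Fy = {C\<in>F. u \<in> C}"
  have fin: "finite Fn" "finite Fy" using finF by (auto simp: Fn_def Fy_def)
  have inj: "inj_on (\<lambda>C. C - {u}) Fy" by (auto simp: Fy_def inj_on_def)
  have "card F = card Fn + card Fy"
    using fin by (subst card_Un_disjoint[symmetric]) (auto simp: Fn_def Fy_def intro!: arg_cong[of _ _ card])
  also have "card Fy = card ((\<lambda>C. C - {u}) ` Fy)" using inj by (simp add: card_image)
  also have "card Fn + \<dots> = card (Fn \<union> (\<lambda>C. C - {u}) ` Fy) + card (Fn \<inter> (\<lambda>C. C - {u}) ` Fy)"
    using fin by (intro card_Un_Int) auto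
  also have "Fn \<union> (\<lambda>C. C - {u}) ` Fy = ?F0"
  proof -
    have "C \<in> (\<lambda>C. C - {u}) ` F" if "C \<in> F" "u \<notin> C" for C
      using that by (intro image_eqI[of _ _ C]) auto
    moreover have "C - {u} \<in> Fn \<union> (\<lambda>C. C - {u}) ` Fy" if "C \<in> F" for C
      using that by (cases "u \<in> C") (auto simp: Fn_def Fy_def)
    ultimately show ?thesis by (auto simp: Fn_def Fy_def)
  qed
  also have "Fn \<inter> (\<lambda>C. C - {u}) ` Fy = ?F1"
  proof -
    have "C \<in> (\<lambda>C. C - {u}) ` Fy" if "u \<notin> C" "insert u C \<in> F" for C
      using that by (intro image_eqI[of _ _ "insert u C"]) (auto simp: Fy_def)
    then show ?thesis by (auto simp: Fn_def Fy_def insert_absorb)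
  qed
  finally have "card F = card ?F0 + card ?F1" .
  also have "card ?F0 \<le> card {A. A \<subseteq> U \<and> shatters ?F0 A}"
    using insert.prems by (intro insert.IH) auto
  also have "{A. A \<subseteq> U \<and> shatters ?F0 A} \<subseteq> {A. A \<subseteq> insert u U \<and> u \<notin> A \<and> shatters F A}"
  proof safe
    fix A assume A: "A \<subseteq> U" "shatters ?F0 A"
    show u: "u \<in> A \<Longrightarrow> False" using A insert.hyps by auto
    show "shatters F A"
      unfolding shatters_def
    proof (intro conjI allI impI)
      show "finite A" using A by (simp add: shatters_def)
      fix B assume "B \<subseteq> A"
      then obtain C where "C \<in> F" "B = A \<inter> (C - {u})" using A unfolding shatters_def by blast
      then show "\<exists>C\<in>F. B = A \<inter> C" using u by (intro bexI[of _ C]) auto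
    qed
  qed auto
  then have "card {A. A \<subseteq> U \<and> shatters ?F0 A} \<le> card {A. A \<subseteq> insert u U \<and> u \<notin> A \<and> shatters F A}"
    using insert.hyps by (intro card_mono) auto
  also have "card ?F1 \<le> card {A. A \<subseteq> U \<and> shatters ?F1 A}"
    using insert.prems by (intro insert.IH) auto
  also have "\<dots> = card (insert u ` {A. A \<subseteq> U \<and> shatters ?F1 A})"
    using insert.hyps by (intro card_image[symmetric]) (auto simp: inj_on_def)
  also have "\<dots> \<le> card {A. A \<subseteq> insert u U \<and> u \<in> A \<and> shatters F A}"
  proof (rule card_mono)
    show "finite {A. A \<subseteq> insert u U \<and> u \<in> A \<and> shatters F A}"
      using insert.hyps by auto
    show "insert u ` {A. A \<subseteq> U \<and> shatters ?F1 A} \<subseteq> {A. A \<subseteq> insert u U \<and> u \<in> A \<and> shatters F A}"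
    proof safe
      fix A assume A: "A \<subseteq> U" "shatters ?F1 A"
      show "shatters F (insert u A)"
        unfolding shatters_def
      proof (intro conjI allI impI)
        show "finite (insert u A)" using A by (simp add: shatters_def)
        fix B assume "B \<subseteq> insert u A"
        then have "B - {u} \<subseteq> A" by auto
        then obtain C where C: "C \<in> ?F1" "B - {u} = A \<inter> C"
          using A(2) unfolding shatters_def by meson
        show "\<exists>C\<in>F. B = insert u A \<inter> C"
        proof (cases "u \<in> B")
          case True
          then show ?thesis using C by (intro bexI[of _ "insert u C"]) auto
        next
          case False
          then show ?thesis using C by (intro bexI[of _ C]) auto
        qed
      qed
    qed auto
  qed
  also have "card {A. A \<subseteq> insert u U \<and> u \<notin> A \<and> shatters F A} + card {A. A \<subseteq> insert u U \<and> u \<in> A \<and> shatters F A}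
     = card {A. A \<subseteq> insert u U \<and> shatters F A}"
    using insert.hyps
    by (subst card_Un_disjoint[symmetric]) (auto intro!: arg_cong[of _ _ card])
  finally show ?case by simp
qed

lemma binomial_mono_upper:
  assumes "m \<le> n"
  shows "m choose k \<le> n choose k"
  using assms
proof (induction n rule: dec_induct)
  case (step n)
  have "n choose k \<le> Suc n choose k" by (cases k) simp_all
  with step.IH show ?case by simp
qed simp

text \<open>
  Weighting the terms with powers of $q = d / s \le 1$ turns the partial sum into at most
  $(1 + q)^s \le e^d$.
\<close>

lemma sum_binomial_le:
  assumes "1 \<le> d" "d \<le> s"
  shows "real (\<Sum>i\<le>d. s choose i) \<le> (exp 1 * s / d) ^ d"
proof -
  define q where "q = real d / real s"
  have q: "0 < q" "q \<le> 1" using assms by (auto simp: q_def)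
  have "real (\<Sum>i\<le>d. s choose i) * q ^ d = (\<Sum>i\<le>d. real (s choose i) * q ^ d)"
    by (simp add: sum_distrib_right)
  also have "\<dots> \<le> (\<Sum>i\<le>d. real (s choose i) * q ^ i)"
    using q by (intro sum_mono mult_left_mono power_decreasing) auto
  also have "\<dots> \<le> (\<Sum>i\<le>s. real (s choose i) * q ^ i)"
    using assms q by (intro sum_mono2) auto
  also have "\<dots> = (q + 1) ^ s"
    by (simp add: binomial_ring)
  also have "\<dots> \<le> exp q ^ s"
    using q exp_ge_add_one_self[of q] by (intro power_mono) (auto simp: add.commute)
  also have "\<dots> = exp 1 ^ d"
    using assms by (simp add: q_def flip: exp_of_nat_mult)
  finally have "real (\<Sum>i\<le>d. s choose i) \<le> exp 1 ^ d / q ^ d"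
    using q by (simp add: field_simps)
  also have "\<dots> = (exp 1 * s / d) ^ d"
    by (simp add: q_def power_divide power_mult_distrib)
  finally show ?thesis .
qed

text \<open>
  The ground set enters only through an upper bound \<open>s\<close> of its cardinality: a sample with repetitions
  may have fewer points than draws, and \<open>s\<close> may be chosen at least \<open>d\<close>.
\<close>

lemma sauer_shelah:
  assumes "finite U" "F \<subseteq> Pow U" "\<And>A. shatters F A \<Longrightarrow> card A \<le> d" "card U \<le> s" "1 \<le> d" "d \<le> s"
  shows "real (card F) \<le> (exp 1 * s / d) ^ d"
proof -
  have "card F \<le> card {A. A \<subseteq> U \<and> shatters F A}"
    by (rule card_le_card_shattered[OF assms(1,2)])
  also have "\<dots> \<le> card (\<Union>i\<le>d. {A. A \<subseteq> U \<and> card A = i})"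
    using assms by (intro card_mono) auto
  also have "\<dots> \<le> (\<Sum>i\<le>d. card {A. A \<subseteq> U \<and> card A = i})"
    by (rule card_UN_le) auto
  also have "\<dots> = (\<Sum>i\<le>d. card U choose i)"
    using assms by (simp add: n_subsets)
  also have "\<dots> \<le> (\<Sum>i\<le>d. s choose i)"
    using assms by (intro sum_mono binomial_mono_upper) auto
  finally have "real (card F) \<le> real (\<Sum>i\<le>d. s choose i)"
    by linarith
  also have "\<dots> \<le> (exp 1 * s / d) ^ d"
    by (rule sum_binomial_le) fact+
  finally show ?thesis .
qed

text \<open>
  A counting argument: of the $|U|^s$ sequences of length $s$, a fraction of at most
  $(1 - \<rho>)^s \le e^{- \<rho> s}$ misses the symmetric difference of a given pair of separated members.
  There are at most $|F|^2$ pairs, so if $|F|^2 e^{- \<rho> s} < 1$, then some sequence tells all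
  members of \<open>F\<close> apart.
\<close>

lemma exists_distinguishing_sample:
  fixes \<rho> :: real
  assumes U: "finite U" "U \<noteq> {}" and F: "F \<subseteq> Pow U"
    and sep: "\<And>S T. S \<in> F \<Longrightarrow> T \<in> F \<Longrightarrow> S \<noteq> T \<Longrightarrow> \<rho> * card U \<le> card (sym_diff S T)"
    and s: "(real (card F))\<^sup>2 * exp (- \<rho> * s) < 1"
  shows "\<exists>R\<subseteq>U. card R \<le> s \<and> inj_on (\<lambda>S. S \<inter> R) F"
proof -
  define \<Omega> where "\<Omega> = ({..<s} \<rightarrow>\<^sub>E U)"
  define bad where "bad = (\<lambda>(S, T). {..<s} \<rightarrow>\<^sub>E (U - sym_diff S T))"
  define D where "D = {(S, T). S \<in> F \<and> T \<in> F \<and> S \<noteq> T}"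
  have finF: "finite F" using U F by (meson finite_Pow_iff finite_subset)
  have DF: "D \<subseteq> F \<times> F" by (auto simp: D_def)
  have finD: "finite D" using DF finF by (meson finite_SigmaI finite_subset)
  have m: "0 < card U" using U by (simp add: card_gt_0_iff)
  have bad_le: "real (card (bad p)) \<le> exp (- \<rho> * s) * card U ^ s" if pD: "p \<in> D" for p
  proof -
    obtain S T where p: "p = (S, T)" "S \<in> F" "T \<in> F" "S \<noteq> T"
      using pD unfolding D_def by blast
    have sub: "sym_diff S T \<subseteq> U" using p F by auto
    have le: "card (sym_diff S T) \<le> card U" using sub U by (intro card_mono) auto
    have "real (card (U - sym_diff S T)) = card U - real (card (sym_diff S T))"
      using sub U le by (subst card_Diff_subset) (auto intro: finite_subset)
    also have "\<dots> \<le> (1 + - \<rho>) * card U" using sep[OF p(2-4)] by (simp add: algebra_simps)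
    also have "\<dots> \<le> exp (- \<rho>) * card U" 
      by (intro mult_right_mono exp_ge_add_one_self) auto
    finally have "real (card (U - sym_diff S T)) ^ s \<le> (exp (- \<rho>) * card U) ^ s"
      by (intro power_mono) auto
    then show ?thesis
      unfolding p(1) bad_def prod.case card_funcsetE[OF finite_lessThan]
      by (simp add: power_mult_distrib mult.commute flip: exp_of_nat_mult)
  qed
  have "real (card (\<Union>p\<in>D. bad p)) \<le> real (\<Sum>p\<in>D. card (bad p))"
    using finD by (intro of_nat_mono card_UN_le)
  also have "\<dots> = (\<Sum>p\<in>D. real (card (bad p)))" by simp
  also have "\<dots> \<le> (\<Sum>p\<in>D. exp (- \<rho> * s) * card U ^ s)"
    by (intro sum_mono bad_le)
  also have "\<dots> = real (card D) * (exp (- \<rho> * s) * card U ^ s)" by simp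
  also have "\<dots> \<le> (real (card F))\<^sup>2 * (exp (- \<rho> * s) * card U ^ s)"
  proof (intro mult_right_mono)
    have "card D \<le> card (F \<times> F)" using DF finF by (intro card_mono) auto
    then show "real (card D) \<le> (real (card F))\<^sup>2" 
      by (simp add: card_cartesian_product power2_eq_square flip: of_nat_mult)
  qed auto
  also have "\<dots> = ((real (card F))\<^sup>2 * exp (- \<rho> * s)) * card U ^ s" by simp
  also have "\<dots> < 1 * real (card U ^ s)"
    using s m by (intro mult_strict_right_mono) auto
  also have "\<dots> = real (card \<Omega>)"
    by (simp add: \<Omega>_def card_funcsetE)
  finally have "card (\<Union>p\<in>D. bad p) < card \<Omega>" by linarith
  moreover have "finite (\<Union>p\<in>D. bad p)"
    using finD U by (auto simp: bad_def intro!: finite_PiE)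
  ultimately have "\<not> \<Omega> \<subseteq> (\<Union>p\<in>D. bad p)"
    using card_mono by (metis linorder_not_less)
  then obtain f where f: "f \<in> \<Omega>" "f \<notin> (\<Union>p\<in>D. bad p)" by blast
  let ?R = "f ` {..<s}"
  have "?R \<subseteq> U" using f(1) by (auto simp: \<Omega>_def)
  moreover have "card ?R \<le> s" using card_image_le[of "{..<s}" f] by simp
  moreover have "inj_on (\<lambda>S. S \<inter> ?R) F"
  proof (rule inj_onI, rule ccontr)
    fix S T assume ST: "S \<in> F" "T \<in> F" "S \<inter> ?R = T \<inter> ?R" "S \<noteq> T"
    then have "f k \<notin> sym_diff S T" if "k < s" for k using that by blast
    then have "f \<in> bad (S, T)"
      using f(1) by (auto simp: bad_def \<Omega>_def PiE_iff)
    then show False using f(2) ST by (auto simp: D_def)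
  qed
  ultimately show ?thesis by blast
qed

text \<open>
  Dudley's packing bound. A separated family of \<open>N\<close> sets keeps its cardinality when it is restricted to
  a sample of about $2 \ln N / \<rho>$ points, and there the Sauer--Shelah lemma bounds \<open>N\<close> by a power
  of the sample size. With $u = \ln N / d$ this reads $e^u \le e (1 + 2 u / \<rho>)$, which forces
  $u \le 2 \ln (7 / \<rho>)$. What matters for chaining is that the bound depends on the separation
  relative to the size of the ground set only, not on the size itself, so that no logarithm of the
  sample size appears in the end.
\<close>

lemma ln_card_packing_le:
  fixes \<rho> :: real
  assumes U: "finite U" "U \<noteq> {}" and F: "F \<subseteq> Pow U" "F \<noteq> {}"
    and vc: "\<And>A. shatters F A \<Longrightarrow> card A \<le> d" and d: "1 \<le> d"
    and \<rho>: "0 < \<rho>" "\<rho> \<le> 1"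
    and sep: "\<And>S T. S \<in> F \<Longrightarrow> T \<in> F \<Longrightarrow> S \<noteq> T \<Longrightarrow> \<rho> * card U \<le> card (sym_diff S T)"
  shows "ln (card F) \<le> 2 * real d * ln (7 / \<rho>)"
proof -
  have finF: "finite F" using U F by (meson finite_Pow_iff finite_subset)
  define N where "N = real (card F)"
  have N: "1 \<le> N" using F finF by (simp add: N_def Suc_le_eq card_gt_0_iff)
  define z where "z = 2 * ln N / \<rho>"
  have z: "0 \<le> z" using N \<rho> by (simp add: z_def)
  \<comment> \<open>The summand \<open>d\<close> keeps the sample size at least \<open>d\<close>, as the Sauer--Shelah bound requires, and
    makes it exceed \<open>z\<close> although the floor rounds down.\<close>
  define s where "s = d + nat \<lfloor>z\<rfloor>"
  have s_gt: "z < s" and s_le: "s \<le> d + z" and ds: "d \<le> s"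
    using z d unfolding s_def by linarith+
  have "exp (2 * ln N) = N\<^sup>2"
    using N exp_of_nat_mult[of 2 "ln N"] by simp
  then have "N\<^sup>2 * exp (- \<rho> * s) = exp (2 * ln N - \<rho> * s)"
    by (simp add: exp_diff exp_minus field_simps)
  also have "\<dots> < 1"
    using s_gt \<rho> by (simp add: z_def field_simps)
  finally obtain R where R: "R \<subseteq> U" "card R \<le> s" "inj_on (\<lambda>S. S \<inter> R) F"
    using exists_distinguishing_sample[OF U F(1) sep, of s] unfolding N_def by auto
  let ?G = "(\<lambda>S. S \<inter> R) ` F"
  have finR: "finite R" using R U by (meson finite_subset)
  have "N = real (card ?G)" using R by (simp add: card_image N_def)
  also have "\<dots> \<le> (exp 1 * s / d) ^ d"
  proof (rule sauer_shelah[OF finR _ _ R(2) d ds])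
    fix A assume A: "shatters ?G A"
    then have "\<exists>S\<in>F. A = A \<inter> (S \<inter> R)" unfolding shatters_def by blast
    then have AR: "A \<subseteq> R" by auto
    have "shatters F A"
      unfolding shatters_def
    proof (intro conjI allI impI)
      show "finite A" using A by (simp add: shatters_def)
      fix B assume "B \<subseteq> A"
      then obtain S where "S \<in> F" "B = A \<inter> (S \<inter> R)" using A unfolding shatters_def by blast
      then show "\<exists>C\<in>F. B = A \<inter> C" using AR by (intro bexI[of _ S]) auto
    qed
    then show "card A \<le> d" by (rule vc)
  qed auto
  finally have N_le: "N \<le> (exp 1 * s / d) ^ d" .
  define u where "u = ln N / d"
  have u: "0 \<le> u" using N by (simp add: u_def)
  have "d * u = ln N" using d by (simp add: u_def)
  then have "exp u ^ d = N"
    using N by (simp flip: exp_of_nat_mult)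
  then have "exp u ^ d \<le> (exp 1 * s / d) ^ d" using N_le by simp
  then have "exp u \<le> exp 1 * s / d"
    using d by (subst (asm) power_mono_iff) auto
  also have "\<dots> \<le> exp 1 * (d + z) / d"
    using s_le d by (intro divide_right_mono mult_left_mono) auto
  also have "\<dots> = exp 1 * (1 + 2 * u / \<rho>)"
    using d by (simp add: z_def u_def field_simps)
  also have "\<dots> = exp 1 + exp 1 * u * (2 / \<rho>)" by (simp add: field_simps)
  finally have 1: "exp u \<le> exp 1 + exp 1 * u * (2 / \<rho>)" .
  define w where "w = exp (u / 2)"
  have w: "1 \<le> w" "w * w = exp u" using u by (auto simp: w_def simp flip: exp_add)
  \<comment> \<open>The linear factor \<open>u\<close> is absorbed by \<open>w\<close>, the square root of \<open>exp u\<close>.\<close>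
  have "1 + (u / 2 - 1) \<le> exp (u / 2 - 1)" by (rule exp_ge_add_one_self)
  then have "exp 1 * u \<le> 2 * w"
    unfolding w_def exp_diff by (simp add: field_simps)
  then have "exp 1 * u * (2 / \<rho>) \<le> 2 * w * (2 / \<rho>)" 
    using \<rho> by (intro mult_right_mono) auto
  moreover have "exp 1 \<le> (3 / \<rho>) * w"
  proof -
    have "exp 1 \<le> (3::real)" by (rule exp_le)
    also have "\<dots> \<le> (3 / \<rho>)" using \<rho> by (simp add: field_simps)
    also have "\<dots> \<le> (3 / \<rho>) * w" using \<rho> w by (simp add: field_simps)
    finally show ?thesis .
  qed
  moreover have "(7 / \<rho>) * w = (3 / \<rho>) * w + 2 * w * (2 / \<rho>)" by (simp add: field_simps)
  ultimately have "w * w \<le> (7 / \<rho>) * w" using 1 w by linarith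
  then have "w \<le> 7 / \<rho>" using w(1) by (subst (asm) mult_le_cancel_right) auto
  then have "ln w \<le> ln (7 / \<rho>)" using w by (intro ln_mono) auto
  then have "u \<le> 2 * ln (7 / \<rho>)" by (simp add: w_def)
  then have "d * u \<le> d * (2 * ln (7 / \<rho>))" by (intro mult_left_mono) auto
  then show ?thesis using \<open>d * u = ln N\<close> by (simp add: N_def mult_ac)
qed

section \<open>Chaining over the traces on a double sample\<close>

text \<open>
  In a double sample, the indices $1, \dots, n$ belong to the sample and $n + 1, \dots, 2 n$ to an
  independent copy (the ghost sample). A set \<open>T\<close> of indices stands for the trace of a member of the
  class. The \<open>i\<close>-th coefficient compares the two copies at \<open>i\<close>; random signs multiply it when the
  copies are exchanged at random.
\<close>

definition swap_coeff :: "nat \<Rightarrow> nat set \<Rightarrow> nat \<Rightarrow> real" where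
  "swap_coeff n T i = indicator T i - indicator T (i + n)"

lemma swap_coeff_bounded: "\<bar>swap_coeff n T i\<bar> \<le> 1"
  by (simp add: swap_coeff_def indicator_def)

lemma sum_double_interval:
  fixes f :: "nat \<Rightarrow> real"
  shows "(\<Sum>k\<in>{1..2 * n}. f k) = (\<Sum>i\<in>{1..n}. f i + f (i + n))"
proof -
  have "(\<Sum>k\<in>{1..2 * n}. f k) = (\<Sum>k\<in>{1..n}. f k) + (\<Sum>k\<in>{n + 1..n + n}. f k)"
    using sum.ub_add_nat[of 1 n f n] by (simp add: mult_2)
  also have "(\<Sum>k\<in>{n + 1..n + n}. f k) = (\<Sum>i\<in>{1..n}. f (i + n))"
    using sum.shift_bounds_cl_nat_ivl[of f 1 n n] by (simp add: add.commute)
  finally show ?thesis by (simp add: sum.distrib)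
qed

lemma sum_swap_coeff_diff_square_le:
  assumes "S \<subseteq> {1..2 * n}" "T \<subseteq> {1..2 * n}"
  shows "(\<Sum>i\<in>{1..n}. (swap_coeff n S i - swap_coeff n T i)\<^sup>2) \<le> 2 * real (card (sym_diff S T))"
proof -
  let ?D = "sym_diff S T"
  have "(swap_coeff n S i - swap_coeff n T i)\<^sup>2 \<le> 2 * (indicator ?D i + indicator ?D (i + n))" for i
    by (auto simp: swap_coeff_def indicator_def)
  then have "(\<Sum>i\<in>{1..n}. (swap_coeff n S i - swap_coeff n T i)\<^sup>2)
      \<le> (\<Sum>i\<in>{1..n}. 2 * (indicator ?D i + indicator ?D (i + n)))"
    by (intro sum_mono)
  also have "\<dots> = 2 * (\<Sum>k\<in>{1..2 * n}. indicator ?D k)"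
    by (subst sum_double_interval) (simp add: sum_distrib_left)
  also have "(\<Sum>k\<in>{1..2 * n}. indicator ?D k) = real (card ?D)"
  proof -
    have "(\<Sum>k\<in>{1..2 * n}. indicator ?D k) = (\<Sum>k\<in>?D. indicator ?D k :: real)"
      using assms by (intro sum.mono_neutral_right) auto
    then show ?thesis by simp
  qed
  finally show ?thesis .
qed

text \<open>
  A maximal separated subfamily is a net, since a set far from all of its members could be added.
\<close>

lemma exists_net:
  fixes r :: real
  assumes "finite F" "0 \<le> r"
  shows "\<exists>G\<subseteq>F. (\<forall>S\<in>G. \<forall>T\<in>G. S \<noteq> T \<longrightarrow> r < card (sym_diff S T)) \<and>
           (\<forall>T\<in>F. \<exists>S\<in>G. card (sym_diff S T) \<le> r)"
proof -
  define sep where "sep G \<longleftrightarrow> G \<subseteq> F \<and> (\<forall>S\<in>G. \<forall>T\<in>G. S \<noteq> T \<longrightarrow> r < card (sym_diff S T))" for G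
  have "{G. sep G} \<subseteq> Pow F" unfolding sep_def by blast
  then have "finite {G. sep G}" by (rule finite_subset) (simp add: assms(1))
  moreover have "{} \<in> {G. sep G}" by (simp add: sep_def)
  ultimately obtain G where G: "sep G" and max: "\<And>H. sep H \<Longrightarrow> G \<subseteq> H \<Longrightarrow> G = H"
    using finite_has_maximal[of "{G. sep G}"] by (metis empty_iff mem_Collect_eq)
  have cover: "\<exists>S\<in>G. card (sym_diff S T) \<le> r" if T: "T \<in> F" for T
  proof (rule ccontr)
    assume far: "\<not> (\<exists>S\<in>G. card (sym_diff S T) \<le> r)"
    then have "sep (insert T G)"
      using G T unfolding sep_def by (auto simp: not_le Un_commute)
    then have "T \<in> G" using max[of "insert T G"] by auto
    then show False using far assms(2) by auto
  qed
  note G' = G[unfolded sep_def]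
  show ?thesis
    by (intro exI[of _ G] conjI conjunct1[OF G'] conjunct2[OF G'] ballI[OF cover])
qed

definition rad_sup :: "nat \<Rightarrow> nat set set \<Rightarrow> nat set \<Rightarrow> real" where
  "rad_sup n F A = (MAX T\<in>F. \<bar>rad_sum {1..n} (swap_coeff n T) A\<bar>)"

lemma rad_sum_diff: "rad_sum I a A - rad_sum I b A = rad_sum I (\<lambda>i. a i - b i) A"
  by (simp add: rad_sum_def sum_subtractf algebra_simps)

text \<open>
  One link of the chain: each set of the finer net \<open>H\<close> is replaced by a nearby set of the coarser
  net \<open>G\<close>. There is one increment per member of \<open>H\<close>, and its variance is at most twice the distance.
\<close>

lemma chaining_step:
  fixes r :: real
  assumes F: "F \<subseteq> Pow {1..2 * n}" and sub: "G \<subseteq> F" "H \<subseteq> F" and ne: "G \<noteq> {}" "H \<noteq> {}"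
    and near: "\<And>T. T \<in> H \<Longrightarrow> \<exists>S\<in>G. card (sym_diff S T) \<le> r" and r: "0 < r"
    and L: "ln (2 * card H) \<le> L"
  shows "rad_mean {1..n} (rad_sup n H) \<le> rad_mean {1..n} (rad_sup n G) + sqrt (4 * r * L)"
proof -
  have fin: "finite F" using F by (rule finite_subset) simp
  have finG: "finite G" and finH: "finite H" using fin sub finite_subset by blast+
  obtain p where p: "\<And>T. T \<in> H \<Longrightarrow> p T \<in> G \<and> card (sym_diff (p T) T) \<le> r"
    using near by metis
  let ?b = "\<lambda>T i. swap_coeff n T i - swap_coeff n (p T) i"
  have "rad_mean {1..n} (rad_sup n H)
      \<le> rad_mean {1..n} (\<lambda>A. rad_sup n G A + (MAX T\<in>H. \<bar>rad_sum {1..n} (?b T) A\<bar>))"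
  proof (rule rad_mean_mono)
    fix A
    show "rad_sup n H A \<le> rad_sup n G A + (MAX T\<in>H. \<bar>rad_sum {1..n} (?b T) A\<bar>)"
      unfolding rad_sup_def[of n H]
    proof (rule Max.boundedI)
      fix y assume "y \<in> (\<lambda>T. \<bar>rad_sum {1..n} (swap_coeff n T) A\<bar>) ` H"
      then obtain T where T: "T \<in> H" "y = \<bar>rad_sum {1..n} (swap_coeff n T) A\<bar>" by blast
      have "\<bar>rad_sum {1..n} (swap_coeff n (p T)) A\<bar> \<le> rad_sup n G A"
        unfolding rad_sup_def using finG p[OF T(1)] by (intro Max_ge) auto
      moreover have "\<bar>rad_sum {1..n} (?b T) A\<bar> \<le> (MAX T\<in>H. \<bar>rad_sum {1..n} (?b T) A\<bar>)"
        using finH T by (intro Max_ge) auto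
      ultimately show "y \<le> rad_sup n G A + (MAX T\<in>H. \<bar>rad_sum {1..n} (?b T) A\<bar>)"
        unfolding T(2) rad_sum_diff[symmetric] by linarith
    qed (use finH ne in auto)
  qed
  also have "\<dots> = rad_mean {1..n} (rad_sup n G) 
      + rad_mean {1..n} (\<lambda>A. MAX T\<in>H. \<bar>rad_sum {1..n} (?b T) A\<bar>)"
    by (rule rad_mean_add)
  also have "rad_mean {1..n} (\<lambda>A. MAX T\<in>H. \<bar>rad_sum {1..n} (?b T) A\<bar>) \<le> sqrt (2 * (2 * r) * L)"
  proof (rule rad_mean_Max_abs_rad_sum_le)
    fix T assume T: "T \<in> H"
    have "(\<Sum>i\<in>{1..n}. (?b T i)\<^sup>2) \<le> 2 * real (card (sym_diff T (p T)))"
      using F sub p[OF T] T by (intro sum_swap_coeff_diff_square_le) auto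
    also have "\<dots> \<le> 2 * r" using p[OF T] by (simp add: Un_commute)
    finally show "(\<Sum>i\<in>{1..n}. (?b T i)\<^sup>2) \<le> 2 * r" .
  qed (use finH ne r L in auto)
  finally show ?thesis by simp
qed

text \<open>
  Dudley's chaining bound, with nets at the relative radii $4^{-j}$. By the packing bound, the net at
  level $j$ has at most $\exp (d (5 + 3 j))$ members, even when counted twice for the two signs. Hence
  the link from level $j$ to level $j + 1$ costs $\sqrt{8 n d} \, (3 + j) / 2^j$. These costs are
  summable, and the nets exhaust the finite family once the radius is below 1.
\<close>

lemma rad_sup_mean_le:
  assumes F: "F \<subseteq> Pow {1..2 * n}" "F \<noteq> {}" and n: "1 \<le> n" and d: "1 \<le> d"
    and vc: "\<And>A. shatters F A \<Longrightarrow> card A \<le> d"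
  shows "rad_mean {1..n} (rad_sup n F) \<le> 10 * sqrt (8 * real n * real d)"
proof -
  let ?U = "{1..2 * n}"
  have fin: "finite F" using F(1) by (rule finite_subset) simp
  define r where "r j = 2 * real n / 4 ^ j" for j :: nat
  have r_pos: "0 < r j" for j using n by (simp add: r_def)
  have "\<forall>j. \<exists>G. G \<subseteq> F \<and> (\<forall>S\<in>G. \<forall>T\<in>G. S \<noteq> T \<longrightarrow> r j < card (sym_diff S T)) \<and>
          (\<forall>T\<in>F. \<exists>S\<in>G. card (sym_diff S T) \<le> r j)"
    by (intro allI exists_net[OF fin less_imp_le[OF r_pos]])
  from choice[OF this] obtain G where G: "\<forall>j. G j \<subseteq> F \<and>
      (\<forall>S\<in>G j. \<forall>T\<in>G j. S \<noteq> T \<longrightarrow> r j < card (sym_diff S T)) \<and>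
      (\<forall>T\<in>F. \<exists>S\<in>G j. card (sym_diff S T) \<le> r j)" ..
  note G_j = G[THEN spec]
  have sub: "G j \<subseteq> F" for j by (rule conjunct1[OF G_j])
  have sep: "r j < card (sym_diff S T)" if "S \<in> G j" "T \<in> G j" "S \<noteq> T" for j S T
    using bspec[OF bspec[OF conjunct1[OF conjunct2[OF G_j]] that(1)] that(2)] that(3) by (rule mp)
  have near: "\<exists>S\<in>G j. card (sym_diff S T) \<le> r j" if "T \<in> F" for j T
    by (rule bspec[OF conjunct2[OF conjunct2[OF G_j]] that])
  have ne: "G j \<noteq> {}" for j using near[of _ j] F(2) by blast
  have ent: "ln (2 * card (G j)) \<le> d * (5 + 3 * real j)" for j
  proof -
    have "finite (G j)" using sub[of j] fin finite_subset by blast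
    then have pos: "0 < card (G j)" using ne by (simp add: card_gt_0_iff)
    have "ln (card (G j)) \<le> 2 * real d * ln (7 / (1 / 4 ^ j))"
    proof (rule ln_card_packing_le[of ?U])
      show "card A \<le> d" if "shatters (G j) A" for A
        using vc shatters_mono[OF that sub] by blast
      show "1 / 4 ^ j * card ?U \<le> card (sym_diff S T)"
        if "S \<in> G j" "T \<in> G j" "S \<noteq> T" for S T
        using sep[OF that] by (simp add: r_def)
      show "G j \<subseteq> Pow ?U" using sub[of j] F(1) by blast
    qed (use n d ne in auto)
    also have "ln (7 / (1 / 4 ^ j) :: real) = ln 7 + j * ln 4"
      by (simp add: ln_mult ln_realpow)
    also have "2 * real d * (ln 7 + j * ln 4) \<le> 2 * real d * (2 + j * (3 / 2))"
    proof (intro mult_left_mono add_mono)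
      have "(7::real) \<le> (1 + 1 / 4 + (1 / 4)\<^sup>2 / 2) ^ 8" by (simp add: power_divide field_simps)
      also have "\<dots> \<le> exp (1 / 4) ^ 8"
        by (intro power_mono exp_lower_Taylor_quadratic) auto
      also have "\<dots> = exp 2" by (simp flip: exp_of_nat_mult)
      finally show "ln (7::real) \<le> 2" by (metis exp_gt_zero ln_exp ln_le_cancel_iff zero_less_numeral)
      show "ln (4::real) \<le> 3 / 2" using ln2_le_25_over_36 ln_realpow[of 2 2] by simp
    qed auto
    finally have "ln (card (G j)) \<le> d * (4 + 3 * real j)" by (simp add: algebra_simps)
    moreover have "ln 2 \<le> real d" using d ln2_le_25_over_36 by linarith
    ultimately show ?thesis
      using pos by (simp add: ln_mult algebra_simps)
  qed
  define K where "K = sqrt (8 * real n * real d)"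
  \<comment> \<open>The closed form of the accumulated costs: 2 for the coarsest net, and
    \<open>(3 + i) / 2 ^ i\<close> for each link \<open>i < j\<close>.\<close>
  have chain: "rad_mean {1..n} (rad_sup n (G j)) \<le> K * (10 - 2 * (4 + real j) / 2 ^ j)" for j
  proof (induction j)
    case 0
    have "rad_mean {1..n} (rad_sup n (G 0)) \<le> sqrt (2 * real n * (real d * (5 + 3 * real 0)))"
      unfolding rad_sup_def
    proof (rule rad_mean_Max_abs_rad_sum_le)
      show "(\<Sum>i\<in>{1..n}. (swap_coeff n T i)\<^sup>2) \<le> real n" for T
        using sum_bounded_above[of "{1..n}" "\<lambda>i. (swap_coeff n T i)\<^sup>2" 1]
          swap_coeff_bounded by (simp add: abs_square_le_1)
      show "finite (G 0)" using sub[of 0] fin finite_subset by blast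
    qed (use ent[of 0] ne n in auto)
    also have "\<dots> \<le> sqrt (8 * real n * real d * 4)"
      by (intro real_sqrt_le_mono) simp
    also have "\<dots> = K * 2" unfolding K_def by (subst real_sqrt_mult) simp
    finally show ?case by simp
  next
    case (Suc j)
    have "rad_mean {1..n} (rad_sup n (G (Suc j))) \<le> rad_mean {1..n} (rad_sup n (G j)) 
        + sqrt (4 * r j * (d * (3 + real j)\<^sup>2))"
    proof (rule chaining_step[OF F(1) sub sub ne ne])
      show "\<exists>S\<in>G j. card (sym_diff S T) \<le> r j" if "T \<in> G (Suc j)" for T
        using near sub that by blast
      have "d * (5 + 3 * real (Suc j)) \<le> d * (3 + real j)\<^sup>2"
        by (intro mult_left_mono) (auto simp: power2_eq_square algebra_simps)
      then show "ln (2 * card (G (Suc j))) \<le> d * (3 + real j)\<^sup>2"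
        using ent[of "Suc j"] by linarith
    qed (rule r_pos)
    also have "4 * r j * (d * (3 + real j)\<^sup>2) = 8 * real n * real d * ((3 + real j) / 2 ^ j)\<^sup>2"
      by (simp add: r_def power_divide power_mult[symmetric] mult.commute[of j] power_mult)
    also have "sqrt \<dots> = K * ((3 + real j) / 2 ^ j)"
      unfolding K_def by (subst real_sqrt_mult) (simp add: real_sqrt_abs)
    finally have "rad_mean {1..n} (rad_sup n (G (Suc j)))
        \<le> K * (10 - 2 * (4 + real j) / 2 ^ j) + K * ((3 + real j) / 2 ^ j)"
      using Suc.IH by linarith
    also have "\<dots> = K * (10 - 2 * (4 + real (Suc j)) / 2 ^ Suc j)"
      by (simp add: field_simps)
    finally show ?case .
  qed
  obtain J :: nat where "2 * real n < 4 ^ J"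
    using real_arch_pow[of 4 "2 * real n"] by auto
  then have J: "r J < 1" by (simp add: r_def)
  have "F \<subseteq> G J"
  proof
    fix T assume T: "T \<in> F"
    from near[OF this, of J] obtain S where S: "S \<in> G J" "card (sym_diff S T) \<le> r J" by blast
    then have "card (sym_diff S T) = 0" using J by linarith
    moreover have "finite S" "finite T"
      using S(1) sub[of J] T F(1) by (blast intro: finite_subset[of _ ?U] finite_atLeastAtMost)+
    ultimately have "S = T" by auto
    then show "T \<in> G J" using S by simp
  qed
  then have "F = G J" using sub by blast
  moreover have "K * (10 - 2 * (4 + real J) / 2 ^ J) \<le> K * 10"
    by (intro mult_left_mono) (auto simp: K_def)
  ultimately show ?thesis using chain[of J] by (simp add: K_def mult.commute)
qed

lemma rad_sup_bounded_differences:
  assumes fin: "finite F" "F \<noteq> {}" and i: "i \<in> {1..n}" "i \<notin> A"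
  shows "\<bar>rad_sup n F (insert i A) - rad_sup n F A\<bar> \<le> 2"
proof -
  have flip: "\<bar>rad_sum {1..n} (swap_coeff n T) (insert i A) - rad_sum {1..n} (swap_coeff n T) A\<bar> \<le> 2" for T
  proof -
    have "rad_sum {1..n} (swap_coeff n T) (insert i A) - rad_sum {1..n} (swap_coeff n T) A
       = (\<Sum>k\<in>{1..n}. if k = i then 2 * swap_coeff n T i else 0)"
      unfolding rad_sum_def sum_subtractf[symmetric]
      using i by (intro sum.cong) (auto simp: sign_of_def)
    also have "\<dots> = 2 * swap_coeff n T i" using i by simp
    finally show ?thesis using swap_coeff_bounded[of n T i] by simp
  qed
  have le: "rad_sup n F B \<le> rad_sup n F B' + 2"
    if *: "\<And>T. \<bar>rad_sum {1..n} (swap_coeff n T) B - rad_sum {1..n} (swap_coeff n T) B'\<bar> \<le> 2" for B B'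
    unfolding rad_sup_def[of n F B]
  proof (rule Max.boundedI)
    fix y assume "y \<in> (\<lambda>T. \<bar>rad_sum {1..n} (swap_coeff n T) B\<bar>) ` F"
    then obtain T where T: "T \<in> F" "y = \<bar>rad_sum {1..n} (swap_coeff n T) B\<bar>" by blast
    have "\<bar>rad_sum {1..n} (swap_coeff n T) B'\<bar> \<le> rad_sup n F B'"
      unfolding rad_sup_def using fin T by (intro Max_ge) auto
    then show "y \<le> rad_sup n F B' + 2" using *[of T] T(2) by linarith
  qed (use fin in auto)
  have "rad_sup n F (insert i A) \<le> rad_sup n F A + 2" by (rule le[OF flip])
  moreover have "rad_sup n F A \<le> rad_sup n F (insert i A) + 2"
    by (rule le) (subst abs_minus_commute, rule flip)
  ultimately show ?thesis by linarith
qed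

text \<open>
  Changing one sign changes the supremum by at most 2, so bounded differences turn the chaining bound
  for the mean into a sub-Gaussian bound around it.
\<close>

lemma rad_sup_mgf_le:
  assumes F: "F \<subseteq> Pow {1..2 * n}" "F \<noteq> {}" and n: "1 \<le> n" and d: "1 \<le> d"
    and vc: "\<And>A. shatters F A \<Longrightarrow> card A \<le> d" and c: "0 \<le> c"
  shows "rad_mean {1..n} (\<lambda>A. exp (c * rad_sup n F A))
     \<le> exp (c * (10 * sqrt (8 * real n * real d)) + c\<^sup>2 * n / 2)"
proof -
  have fin: "finite F" using F(1) by (rule finite_subset) simp
  have "rad_mean {1..n} (\<lambda>A. exp (c * rad_sup n F A)) 
      \<le> exp (c * rad_mean {1..n} (rad_sup n F) + c\<^sup>2 * card {1..n} / 2)"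
    by (intro bounded_differences_mgf rad_sup_bounded_differences fin F) auto
  also have "\<dots> \<le> exp (c * (10 * sqrt (8 * real n * real d)) + c\<^sup>2 * n / 2)"
    using rad_sup_mean_le[OF F n d vc] c by (simp add: mult_left_mono)
  finally show ?thesis .
qed

section \<open>Symmetrization with a ghost sample\<close>

definition emp_dev :: "'b measure \<Rightarrow> nat \<Rightarrow> 'b set set \<Rightarrow> (nat \<Rightarrow> 'b) \<Rightarrow> real" where
  "emp_dev P n \<C> \<omega> = (SUP C\<in>\<C>. \<bar>\<Sum>i=1..n. indicator C (\<omega> i) - measure P C\<bar>)"

definition swap_dev :: "nat \<Rightarrow> 'b set set \<Rightarrow> nat set \<Rightarrow> (nat \<Rightarrow> 'b) \<Rightarrow> real" where
  "swap_dev n \<C> A \<omega> = (SUP C\<in>\<C>. \<bar>\<Sum>i=1..n. sign_of A i * (indicator C (\<omega> i) - indicator C (\<omega> (i + n)))\<bar>)"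

lemma abs_sum_le_of_abs_le_one:
  fixes f :: "nat \<Rightarrow> real"
  assumes "\<And>i. i \<in> {1..n} \<Longrightarrow> \<bar>f i\<bar> \<le> 1"
  shows "\<bar>\<Sum>i=1..n. f i\<bar> \<le> n"
  using order_trans[OF sum_abs sum_bounded_above[of "{1..n}" "\<lambda>i. \<bar>f i\<bar>" 1]] assms by simp

lemma swap_dev_term_le: "\<bar>\<Sum>i=1..n. sign_of A i * (indicator C (\<omega> i) - indicator C (\<omega> (i + n)))\<bar> \<le> real n"
  by (rule abs_sum_le_of_abs_le_one) (auto simp: sign_of_def indicator_def)

lemma emp_dev_term_le:
  assumes "prob_space P"
  shows "\<bar>\<Sum>i=1..n. indicator C (\<omega> i) - measure P C\<bar> \<le> real n"
proof (rule abs_sum_le_of_abs_le_one)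
  interpret prob_space P by fact
  have "\<bar>b - p\<bar> \<le> 1" if "b = 0 \<or> b = 1" "0 \<le> p" "p \<le> 1" for b p :: real
    using that by auto
  then show "\<bar>indicator C (\<omega> i) - prob C\<bar> \<le> 1" for i
    by (auto simp: indicator_def)
qed

lemma swap_dev_bdd: "bdd_above ((\<lambda>C. \<bar>\<Sum>i=1..n. sign_of A i * (indicator C (\<omega> i) - indicator C (\<omega> (i + n)))\<bar>) ` \<C>)"
  using swap_dev_term_le by (intro bdd_aboveI[of _ "real n"]) auto

lemma emp_dev_bdd:
  fixes n :: nat
  assumes "prob_space P"
  shows "bdd_above ((\<lambda>C. \<bar>\<Sum>i=1..n. indicator C (\<omega> i) - measure P C\<bar>) ` \<C>)"
  using emp_dev_term_le[OF assms] by (intro bdd_aboveI[of _ "real n"]) auto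

lemma swap_dev_le:
  assumes "\<C> \<noteq> {}"
  shows "swap_dev n \<C> A \<omega> \<le> n" "0 \<le> swap_dev n \<C> A \<omega>"
proof -
  show "swap_dev n \<C> A \<omega> \<le> n"
    unfolding swap_dev_def by (rule cSUP_least[OF assms swap_dev_term_le])
  obtain C where "C \<in> \<C>" using assms by auto
  from cSUP_upper[OF this swap_dev_bdd] show "0 \<le> swap_dev n \<C> A \<omega>"
    unfolding swap_dev_def by (rule order_trans[OF abs_ge_zero])
qed

lemma emp_dev_le:
  assumes "\<C> \<noteq> {}" "prob_space P"
  shows "emp_dev P n \<C> \<omega> \<le> n"
  unfolding emp_dev_def by (rule cSUP_least[OF assms(1) emp_dev_term_le[OF assms(2)]])

lemma measurable_swap_dev:
  assumes "countable \<C>" "\<C> \<subseteq> sets P"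
  shows "swap_dev n \<C> A \<in> borel_measurable (PiM {1..2 * n} (\<lambda>_. P))"
  unfolding swap_dev_def
proof (rule borel_measurable_cSUP[OF assms(1) _ swap_dev_bdd])
  fix C assume "C \<in> \<C>"
  then have [measurable]: "C \<in> sets P" using assms by auto
  have "(\<lambda>\<omega>. \<Sum>i=1..n. sign_of A i * (indicator C (\<omega> i) - indicator C (\<omega> (i + n))))
      \<in> borel_measurable (PiM {1..2 * n} (\<lambda>_. P))"
  proof (rule borel_measurable_sum)
    fix i assume "i \<in> {1..n}"
    then have [measurable]: "(\<lambda>\<omega>. \<omega> i) \<in> measurable (PiM {1..2 * n} (\<lambda>_. P)) P"
      "(\<lambda>\<omega>. \<omega> (i + n)) \<in> measurable (PiM {1..2 * n} (\<lambda>_. P)) P"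
      by (auto intro!: measurable_component_singleton)
    show "(\<lambda>\<omega>. sign_of A i * (indicator C (\<omega> i) - indicator C (\<omega> (i + n))))
      \<in> borel_measurable (PiM {1..2 * n} (\<lambda>_. P))" by measurable
  qed
  then show "(\<lambda>\<omega>. \<bar>\<Sum>i=1..n. sign_of A i * (indicator C (\<omega> i) - indicator C (\<omega> (i + n)))\<bar>)
      \<in> borel_measurable (PiM {1..2 * n} (\<lambda>_. P))" by measurable
qed

lemma measurable_emp_dev:
  assumes "countable \<C>" "\<C> \<subseteq> sets P" "prob_space P"
  shows "emp_dev P n \<C> \<in> borel_measurable (PiM {1..n} (\<lambda>_. P))"
  unfolding emp_dev_def
proof (rule borel_measurable_cSUP[OF assms(1) _ emp_dev_bdd[OF assms(3)]])
  fix C assume "C \<in> \<C>"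
  then have [measurable]: "C \<in> sets P" using assms by auto
  have "(\<lambda>\<omega>. \<Sum>i=1..n. indicator C (\<omega> i) - measure P C)
      \<in> borel_measurable (PiM {1..n} (\<lambda>_. P))"
  proof (rule borel_measurable_sum)
    fix i assume "i \<in> {1..n}"
    then have [measurable]: "(\<lambda>\<omega>. \<omega> i) \<in> measurable (PiM {1..n} (\<lambda>_. P)) P"
      by (auto intro!: measurable_component_singleton)
    show "(\<lambda>\<omega>. indicator C (\<omega> i) - measure P C)
      \<in> borel_measurable (PiM {1..n} (\<lambda>_. P))" by measurable
  qed
  then show "(\<lambda>\<omega>. \<bar>\<Sum>i=1..n. indicator C (\<omega> i) - measure P C\<bar>)
      \<in> borel_measurable (PiM {1..n} (\<lambda>_. P))" by measurable
qed

text \<open>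
  The probability of \<open>C\<close> is the expected value of its indicator at a ghost point. Pulling this
  expectation out of the sum, of the absolute value and of the supremum, and finally out of the
  exponential by Jensen's inequality, only increases the left side.
\<close>

lemma symmetrization:
  fixes P :: "'b measure"
  assumes P: "prob_space P" and \<C>: "countable \<C>" "\<C> \<subseteq> sets P" "\<C> \<noteq> {}" and c: "0 \<le> c"
  shows "(\<integral>x. exp (c * emp_dev P n \<C> x) \<partial>PiM {1..n} (\<lambda>_. P))
     \<le> (\<integral>\<omega>. exp (c * swap_dev n \<C> {1..n} \<omega>) \<partial>PiM {1..2 * n} (\<lambda>_. P))"
proof -
  interpret P: prob_space P by fact
  interpret product_sigma_finite "\<lambda>_::nat. P" by unfold_locales
  let ?I = "{1..n}" and ?J = "{n<..2 * n}"
  let ?S = "swap_dev n \<C> {1..n}"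
  have IJ: "?I \<inter> ?J = {}" "?I \<union> ?J = {1..2 * n}" by auto
  interpret QI: prob_space "PiM ?I (\<lambda>_. P)" by (intro prob_space_PiM P)
  interpret QJ: prob_space "PiM ?J (\<lambda>_. P)" by (intro prob_space_PiM P)
  interpret Q: prob_space "PiM {1..2 * n} (\<lambda>_. P)" by (intro prob_space_PiM P)
  have S_meas[measurable]: "?S \<in> borel_measurable (PiM {1..2 * n} (\<lambda>_. P))"
    by (rule measurable_swap_dev[OF \<C>(1,2)])
  have merge_meas[measurable]: "merge ?I ?J \<in> measurable (PiM ?I (\<lambda>_. P) \<Otimes>\<^sub>M PiM ?J (\<lambda>_. P)) (PiM {1..2 * n} (\<lambda>_. P))"
    using measurable_merge[of ?I ?J "\<lambda>_. P"] by (simp only: IJ)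
  have S_bound: "norm (?S \<omega>) \<le> n" for \<omega>
    using swap_dev_le[OF \<C>(3), of n "{1..n}" \<omega>] by simp
  have e_bound: "norm (exp (c * ?S \<omega>)) \<le> exp (c * n)" for \<omega>
    using swap_dev_le(1)[OF \<C>(3), of n "{1..n}" \<omega>] c by (simp add: mult_left_mono)
  have int_Q: "integrable (PiM {1..2 * n} (\<lambda>_. P)) (\<lambda>\<omega>. exp (c * ?S \<omega>))"
    by (rule Q.integrable_const_bound[OF AE_I2[OF e_bound]]) measurable
  have sec: "(\<lambda>y. merge ?I ?J (x, y)) \<in> measurable (PiM ?J (\<lambda>_. P)) (PiM {1..2 * n} (\<lambda>_. P))"
    if "x \<in> space (PiM ?I (\<lambda>_. P))" for x
    using measurable_compose[OF measurable_Pair1'[OF that] merge_meas] .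
  have pw: "exp (c * emp_dev P n \<C> x) \<le> (\<integral>y. exp (c * ?S (merge ?I ?J (x, y))) \<partial>PiM ?J (\<lambda>_. P))"
    if x: "x \<in> space (PiM ?I (\<lambda>_. P))" for x
  proof -
    note [measurable] = sec[OF x]
    have int_S: "integrable (PiM ?J (\<lambda>_. P)) (\<lambda>y. ?S (merge ?I ?J (x, y)))"
      by (rule QJ.integrable_const_bound[OF AE_I2[OF S_bound]]) measurable
    have int_e: "integrable (PiM ?J (\<lambda>_. P)) (\<lambda>y. exp (c * ?S (merge ?I ?J (x, y))))"
      by (rule QJ.integrable_const_bound[OF AE_I2[OF e_bound]]) measurable
    have "emp_dev P n \<C> x \<le> (\<integral>y. ?S (merge ?I ?J (x, y)) \<partial>PiM ?J (\<lambda>_. P))"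
      unfolding emp_dev_def
    proof (rule cSUP_least[OF \<C>(3)])
      fix C assume C: "C \<in> \<C>"
      then have C_meas: "C \<in> sets P" using \<C> by auto
      let ?h = "\<lambda>y. \<Sum>i=1..n. indicator C (x i) - indicator C (y (i + n)) :: real"
      have coord: "integrable (PiM ?J (\<lambda>_. P)) (\<lambda>y. indicator C (y (i + n)) :: real)"
        "(\<integral>y. indicator C (y (i + n)) \<partial>PiM ?J (\<lambda>_. P)) = measure P C" if i: "i \<in> ?I" for i
      proof -
        have iJ: "i + n \<in> ?J" using i by auto
        have comp: "(\<lambda>y. y (i + n)) \<in> measurable (PiM ?J (\<lambda>_. P)) P"
          using iJ by (rule measurable_component_singleton)
        have dist: "distr (PiM ?J (\<lambda>_. P)) P (\<lambda>y. y (i + n)) = P"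
          using iJ by (intro distr_PiM_component[of ?J "\<lambda>_. P"] P)
        have "integrable P (indicator C :: _ \<Rightarrow> real)"
          using C_meas by (simp add: integrable_indicator_iff P.emeasure_eq_measure)
        then show "integrable (PiM ?J (\<lambda>_. P)) (\<lambda>y. indicator C (y (i + n)) :: real)"
          using integrable_distr[OF comp, of "indicator C :: _ \<Rightarrow> real"] unfolding dist by simp
        have "(\<integral>y. indicator C (y (i + n)) \<partial>PiM ?J (\<lambda>_. P)) = (\<integral>z. indicator C z \<partial>P :: real)"
          using integral_distr[OF comp, of "indicator C :: _ \<Rightarrow> real"] C_meas unfolding dist by simp
        then show "(\<integral>y. indicator C (y (i + n)) \<partial>PiM ?J (\<lambda>_. P)) = measure P C"
          using C_meas by simp
      qed
      have int_h: "integrable (PiM ?J (\<lambda>_. P)) ?h"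
        using coord by (intro Bochner_Integration.integrable_sum Bochner_Integration.integrable_diff QJ.integrable_const)
      have "(\<Sum>i=1..n. indicator C (x i) - measure P C) = (\<integral>y. ?h y \<partial>PiM ?J (\<lambda>_. P))"
        using coord by (subst Bochner_Integration.integral_sum) (auto simp: QJ.prob_space)
      then have "\<bar>\<Sum>i=1..n. indicator C (x i) - measure P C\<bar> \<le> (\<integral>y. \<bar>?h y\<bar> \<partial>PiM ?J (\<lambda>_. P))"
        by (simp add: integral_abs_bound)
      also have "\<dots> \<le> (\<integral>y. ?S (merge ?I ?J (x, y)) \<partial>PiM ?J (\<lambda>_. P))"
      proof (rule integral_mono[OF integrable_abs[OF int_h] int_S])
        fix y
        let ?w = "merge ?I ?J (x, y)"
        have "?h y = (\<Sum>i=1..n. sign_of {1..n} i * (indicator C (?w i) - indicator C (?w (i + n))))"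
          by (intro sum.cong) (auto simp: sign_of_def merge_def)
        then show "\<bar>?h y\<bar> \<le> ?S ?w"
          unfolding swap_dev_def by (simp only: cSUP_upper[OF C swap_dev_bdd])
      qed
      finally show "\<bar>\<Sum>i=1..n. indicator C (x i) - measure P C\<bar>
          \<le> (\<integral>y. ?S (merge ?I ?J (x, y)) \<partial>PiM ?J (\<lambda>_. P))" .
    qed
    then have "exp (c * emp_dev P n \<C> x) \<le> exp (c * (\<integral>y. ?S (merge ?I ?J (x, y)) \<partial>PiM ?J (\<lambda>_. P)))"
      using c by (simp add: mult_left_mono)
    also have "\<dots> \<le> (\<integral>y. exp (c * ?S (merge ?I ?J (x, y))) \<partial>PiM ?J (\<lambda>_. P))"
      by (rule QJ.jensens_inequality[OF int_S _ _ int_e convex_on_exp[OF c]]) auto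
    finally show ?thesis .
  qed
  have "(\<integral>x. exp (c * emp_dev P n \<C> x) \<partial>PiM ?I (\<lambda>_. P))
      \<le> (\<integral>x. (\<integral>y. exp (c * ?S (merge ?I ?J (x, y))) \<partial>PiM ?J (\<lambda>_. P)) \<partial>PiM ?I (\<lambda>_. P))"
  proof (rule integral_mono[OF _ _ pw])
    have "exp (c * emp_dev P n \<C> x) \<le> exp (c * n)" for x
      using emp_dev_le[OF \<C>(3) P, of n x] c by (simp add: mult_left_mono)
    then show "integrable (PiM ?I (\<lambda>_. P)) (\<lambda>x. exp (c * emp_dev P n \<C> x))"
      using measurable_emp_dev[OF \<C>(1,2) P]
      by (intro QI.integrable_const_bound[of _ "exp (c * n)"]) auto
    show "integrable (PiM ?I (\<lambda>_. P)) (\<lambda>x. \<integral>y. exp (c * ?S (merge ?I ?J (x, y))) \<partial>PiM ?J (\<lambda>_. P))"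
    proof (rule QI.integrable_const_bound[of _ "exp (c * n)"])
      show "AE x in PiM ?I (\<lambda>_. P). norm (\<integral>y. exp (c * ?S (merge ?I ?J (x, y))) \<partial>PiM ?J (\<lambda>_. P)) \<le> exp (c * n)"
      proof (rule AE_I2)
        fix x assume x: "x \<in> space (PiM ?I (\<lambda>_. P))"
        note [measurable] = sec[OF x]
        have "integrable (PiM ?J (\<lambda>_. P)) (\<lambda>y. exp (c * ?S (merge ?I ?J (x, y))))"
          by (rule QJ.integrable_const_bound[OF AE_I2[OF e_bound]]) measurable
        then have "(\<integral>y. exp (c * ?S (merge ?I ?J (x, y))) \<partial>PiM ?J (\<lambda>_. P)) \<le> exp (c * n)"
          using e_bound by (intro QJ.integral_le_const) auto
        then show "norm (\<integral>y. exp (c * ?S (merge ?I ?J (x, y))) \<partial>PiM ?J (\<lambda>_. P)) \<le> exp (c * n)"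
          by (simp add: integral_nonneg)
      qed
      show "(\<lambda>x. \<integral>y. exp (c * ?S (merge ?I ?J (x, y))) \<partial>PiM ?J (\<lambda>_. P)) \<in> borel_measurable (PiM ?I (\<lambda>_. P))"
        by measurable
    qed
  qed
  also have "\<dots> = (\<integral>\<omega>. exp (c * ?S \<omega>) \<partial>PiM {1..2 * n} (\<lambda>_. P))"
    using product_integral_fold[OF IJ(1) _ _ int_Q[folded IJ(2)]] unfolding IJ(2) by simp
  finally show ?thesis .
qed

text \<open>
  Exchanging a sample point with its ghost preserves the product measure and flips the sign of the
  corresponding summand.
\<close>

lemma swap_dev_exchangeable:
  fixes P :: "'b measure"
  assumes P: "prob_space P" and \<C>: "countable \<C>" "\<C> \<subseteq> sets P"
  shows "(\<integral>\<omega>. exp (c * swap_dev n \<C> {1..n} \<omega>) \<partial>PiM {1..2 * n} (\<lambda>_. P))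
      = (\<integral>\<omega>. exp (c * swap_dev n \<C> A \<omega>) \<partial>PiM {1..2 * n} (\<lambda>_. P))"
proof -
  let ?U = "{1..2 * n}" and ?Q = "PiM {1..2 * n} (\<lambda>_. P)"
  \<comment> \<open>The involution that exchanges \<open>i\<close> and \<open>i + n\<close> for the indices \<open>i\<close> outside \<open>A\<close>.\<close>
  define f where "f k = (if k \<le> n then if k \<in> A then k else k + n
                         else if k - n \<in> A then k else k - n)" for k
  have f: "f \<in> ?U \<rightarrow> ?U" by (auto simp: f_def)
  have "f (f k) = k" if "k \<in> ?U" for k using that by (auto simp: f_def)
  then have inj: "inj_on f ?U" by (metis inj_on_inverseI)
  have dist: "distr ?Q ?Q (\<lambda>\<omega>. \<lambda>k\<in>?U. \<omega> (f k)) = ?Q"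
    using distr_PiM_reindex[of ?U "\<lambda>_. P", OF P inj f] .
  have meas: "(\<lambda>\<omega>. \<lambda>k\<in>?U. \<omega> (f k)) \<in> measurable ?Q ?Q"
    using f by (intro measurable_restrict measurable_component_singleton) auto
  have "(\<integral>\<omega>. exp (c * swap_dev n \<C> {1..n} \<omega>) \<partial>?Q)
      = (\<integral>\<omega>. exp (c * swap_dev n \<C> {1..n} (\<lambda>k\<in>?U. \<omega> (f k))) \<partial>?Q)"
    using measurable_swap_dev[OF \<C>, of n "{1..n}"]
    by (subst dist[symmetric], subst integral_distr[OF meas]) auto
  also have "\<dots> = (\<integral>\<omega>. exp (c * swap_dev n \<C> A \<omega>) \<partial>?Q)"
  proof -
    have "swap_dev n \<C> {1..n} (\<lambda>k\<in>?U. \<omega> (f k)) = swap_dev n \<C> A \<omega>" for \<omega>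
      unfolding swap_dev_def
      by (intro SUP_cong refl arg_cong[where f = abs] sum.cong) (auto simp: sign_of_def f_def)
    then show ?thesis by simp
  qed
  finally show ?thesis .
qed

lemma swap_dev_eq_rad_sup:
  assumes "\<C> \<noteq> {}"
  shows "swap_dev n \<C> A \<omega> = rad_sup n ((\<lambda>C. {i\<in>{1..2 * n}. \<omega> i \<in> C}) ` \<C>) A"
proof -
  let ?t = "\<lambda>C. {i\<in>{1..2 * n}. \<omega> i \<in> C}"
  let ?g = "\<lambda>T. \<bar>rad_sum {1..n} (swap_coeff n T) A\<bar>"
  have "\<bar>\<Sum>i=1..n. sign_of A i * (indicator C (\<omega> i) - indicator C (\<omega> (i + n)))\<bar> = ?g (?t C)" for C
    unfolding rad_sum_def swap_coeff_def
    by (intro arg_cong[where f = abs] sum.cong) (auto simp: indicator_def)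
  then have "swap_dev n \<C> A \<omega> = Sup (?g ` ?t ` \<C>)"
    unfolding swap_dev_def image_image by simp
  also have "finite (?t ` \<C>)" by (rule finite_subset[of _ "Pow {1..2 * n}"]) auto
  then have "Sup (?g ` ?t ` \<C>) = Max (?g ` ?t ` \<C>)"
    using assms by (intro cSup_eq_Max) auto
  finally show ?thesis unfolding rad_sup_def .
qed

text \<open>
  A set of indices shattered by the traces cannot contain two indices of the same point, so it
  corresponds to a set of equally many points, which the class itself shatters. Thus coinciding sample
  points do no harm.
\<close>

lemma shattered_trace_card_le:
  assumes vc: "VC_class X \<C> d" and \<omega>: "\<And>i. i \<in> U \<Longrightarrow> \<omega> i \<in> X"
    and sh: "shatters ((\<lambda>C. {i\<in>U. \<omega> i \<in> C}) ` \<C>) A"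
  shows "card A \<le> d"
proof -
  have fin: "finite A" using sh by (simp add: shatters_def)
  have tr: "\<exists>C\<in>\<C>. B = A \<inter> {i\<in>U. \<omega> i \<in> C}" if "B \<subseteq> A" for B
    using sh that unfolding shatters_def by blast
  have AU: "A \<subseteq> U" using tr[OF subset_refl] by blast
  have inj: "inj_on \<omega> A"
  proof (rule inj_onI)
    fix i j assume ij: "i \<in> A" "j \<in> A" "\<omega> i = \<omega> j"
    obtain C where C: "{i} = A \<inter> {i\<in>U. \<omega> i \<in> C}" using tr[of "{i}"] ij by blast
    then have "\<omega> i \<in> C" by blast
    then have "j \<in> A \<inter> {i\<in>U. \<omega> i \<in> C}" using ij AU by auto
    then have "j \<in> {i}" unfolding C[symmetric] .
    then show "i = j" by simp
  qed
  have "shatters \<C> (\<omega> ` A)"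
    unfolding shatters_def
  proof (intro conjI allI impI)
    show "finite (\<omega> ` A)" using fin by simp
    fix B assume B: "B \<subseteq> \<omega> ` A"
    obtain C where C: "C \<in> \<C>" "{i\<in>A. \<omega> i \<in> B} = A \<inter> {i\<in>U. \<omega> i \<in> C}"
      using tr[of "{i\<in>A. \<omega> i \<in> B}"] by blast
    have "\<omega> i \<in> B \<longleftrightarrow> \<omega> i \<in> C" if "i \<in> A" for i
      using that C(2) AU by blast
    then have "B = \<omega> ` A \<inter> C" using B by blast
    then show "\<exists>C\<in>\<C>. B = \<omega> ` A \<inter> C" using C(1) by blast
  qed
  moreover have "\<omega> ` A \<subseteq> X" using AU \<omega> by blast
  ultimately have "card (\<omega> ` A) \<le> d" using vc unfolding VC_class_def by blast
  then show ?thesis using inj by (simp add: card_image)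
qed

text \<open>
  The exponential moment of the double sample does not depend on the signs, so it equals its average
  over all signs. Exchanging this average with the integral leaves, for every fixed double sample, a
  purely combinatorial average, which is bounded uniformly in the sample.
\<close>

lemma emp_dev_mgf_le:
  fixes P :: "'b measure"
  assumes P: "prob_space P" and \<C>: "countable \<C>" "\<C> \<subseteq> sets P" "\<C> \<noteq> {}" and c: "0 \<le> c"
    and vc: "VC_class (space P) \<C> d" and n: "1 \<le> n" and d: "1 \<le> d"
  shows "(\<integral>x. exp (c * emp_dev P n \<C> x) \<partial>PiM {1..n} (\<lambda>_. P))
     \<le> exp (c * (10 * sqrt (8 * real n * real d)) + c\<^sup>2 * n / 2)"
proof -
  let ?Q = "PiM {1..2 * n} (\<lambda>_. P)"
  let ?e = "\<lambda>A \<omega>. exp (c * swap_dev n \<C> A \<omega>)"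
  interpret Q: prob_space ?Q by (intro prob_space_PiM P)
  have int: "integrable ?Q (?e A)" for A
    using measurable_swap_dev[OF \<C>(1,2), of n A] swap_dev_le(1)[OF \<C>(3), of n A] c
    by (intro Q.integrable_const_bound[of _ "exp (c * n)"]) (auto simp: mult_left_mono)
  have "(\<integral>x. exp (c * emp_dev P n \<C> x) \<partial>PiM {1..n} (\<lambda>_. P)) \<le> (\<integral>\<omega>. ?e {1..n} \<omega> \<partial>?Q)"
    by (rule symmetrization[OF P \<C> c])
  also have "\<dots> = rad_mean {1..n} (\<lambda>A. \<integral>\<omega>. ?e {1..n} \<omega> \<partial>?Q)"
    by (simp add: rad_mean_const)
  also have "\<dots> = rad_mean {1..n} (\<lambda>A. \<integral>\<omega>. ?e A \<omega> \<partial>?Q)"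
    by (intro rad_mean_cong swap_dev_exchangeable[OF P \<C>(1,2)])
  also have "\<dots> = (\<integral>\<omega>. rad_mean {1..n} (\<lambda>A. ?e A \<omega>) \<partial>?Q)"
    unfolding rad_mean_def using int by (simp add: Bochner_Integration.integral_sum)
  also have "\<dots> \<le> exp (c * (10 * sqrt (8 * real n * real d)) + c\<^sup>2 * n / 2)"
  proof (rule Q.integral_le_const)
    show "integrable ?Q (\<lambda>\<omega>. rad_mean {1..n} (\<lambda>A. ?e A \<omega>))"
      unfolding rad_mean_def using int by auto
    show "AE \<omega> in ?Q. rad_mean {1..n} (\<lambda>A. ?e A \<omega>) \<le> exp (c * (10 * sqrt (8 * real n * real d)) + c\<^sup>2 * n / 2)"
    proof (rule AE_I2)
      fix \<omega> assume \<omega>: "\<omega> \<in> space ?Q"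
      have pts: "\<omega> i \<in> space P" if "i \<in> {1..2 * n}" for i
        using \<omega> that by (auto simp: space_PiM PiE_iff)
      show "rad_mean {1..n} (\<lambda>A. ?e A \<omega>) \<le> exp (c * (10 * sqrt (8 * real n * real d)) + c\<^sup>2 * n / 2)"
        unfolding swap_dev_eq_rad_sup[OF \<C>(3)]
      proof (rule rad_sup_mgf_le[OF _ _ n d _ c])
        show "card A \<le> d" if "shatters ((\<lambda>C. {i \<in> {1..2 * n}. \<omega> i \<in> C}) ` \<C>) A" for A
          using shattered_trace_card_le[OF vc pts that] .
      qed (use \<C>(3) in auto)
    qed
  qed
  finally show ?thesis .
qed

theorem theorem1:
  fixes M :: "'a measure" and X P :: "'b measure"
    and \<xi> :: "nat \<Rightarrow> 'a \<Rightarrow> 'b"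
    and \<C> :: "'b set set" and n d :: nat and \<eta> x :: real
  assumes "prob_space M"
    and "n \<ge> 1"
    and "prob_space.indep_vars M (\<lambda>_. X) \<xi> {1..n}"
    and "\<And>i. i \<in> {1..n} \<Longrightarrow> distr M X (\<xi> i) = P"
    and "\<C> \<subseteq> sets X"
    and "countable \<C>"
    and "VC_class (space X) \<C> d"
    and "d \<ge> 1"
    and "\<eta> > 0"
    and "x > 0"
  shows "\<P>(\<omega> in M.
            (SUP C\<in>\<C>. \<bar>\<Sum>i=1..n. (indicator C (\<xi> i \<omega>) - measure P C)\<bar>)
            \<ge> 1015 * (1 + \<eta>) * real d * (1 + sqrt (1 + 2 * real n / (1015 * real d)))
              + 2 * sqrt (real n * x) + (5 / 2 + 32 / \<eta>) * x)
         \<le> 2 * exp (- x)"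
proof -
  interpret M: prob_space M by fact
  have rv: "\<xi> i \<in> measurable M X" if "i \<in> {1..n}" for i
    using M.indep_vars_def2[of "\<lambda>_. X" \<xi> "{1..n}"] assms(3) that by auto
  have dP: "P = distr M X (\<xi> 1)" using assms(2,4) by simp
  have P: "prob_space P" unfolding dP using assms(2) by (intro M.prob_space_distr rv) auto
  have sets_P: "sets P = sets X" and space_P: "space P = space X" by (simp_all add: dP)
  have ne: "\<C> \<noteq> {}"
    using assms(7) unfolding VC_class_def shatters_def by blast
  have \<C>: "countable \<C>" "\<C> \<subseteq> sets P" using assms(5,6) sets_P by auto
  let ?Q = "PiM {1..n} (\<lambda>_. P)"
  let ?\<xi> = "\<lambda>\<omega>. \<lambda>i\<in>{1..n}. \<xi> i \<omega>"
  have joint: "distr M ?Q ?\<xi> = ?Q"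
  proof -
    have "distr M (PiM {1..n} (\<lambda>_. X)) ?\<xi> = (\<Pi>\<^sub>M i\<in>{1..n}. distr M X (\<xi> i))"
      using assms(2,3) rv by (subst M.indep_vars_iff_distr_eq_PiM'[symmetric]) auto
    moreover have "(\<Pi>\<^sub>M i\<in>{1..n}. distr M X (\<xi> i)) = ?Q"
      using assms(4) by (intro PiM_cong) auto
    moreover have "distr M (PiM {1..n} (\<lambda>_. X)) ?\<xi> = distr M ?Q ?\<xi>"
      by (intro distr_cong sets_PiM_cong refl) (simp_all add: sets_P)
    ultimately show ?thesis by simp
  qed
  have \<xi>_meas[measurable]: "?\<xi> \<in> measurable M ?Q"
    using rv by (intro measurable_restrict) (simp add: measurable_cong_sets[OF refl sets_P])
  have Z_meas[measurable]: "emp_dev P n \<C> \<in> borel_measurable ?Q"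
    by (rule measurable_emp_dev[OF \<C> P])
  define Z where "Z \<omega> = emp_dev P n \<C> (?\<xi> \<omega>)" for \<omega>
  have Z_eq: "(SUP C\<in>\<C>. \<bar>\<Sum>i=1..n. (indicator C (\<xi> i \<omega>) - measure P C)\<bar>) = Z \<omega>" for \<omega>
    unfolding Z_def emp_dev_def by (intro SUP_cong refl arg_cong[where f = abs] sum.cong) auto
  have [measurable]: "Z \<in> borel_measurable M" unfolding Z_def by measurable
  \<comment> \<open>The minimizer of \<open>- c * (2 * sqrt (n * x)) + c\<^sup>2 * n / 2\<close>, the exponent of the
    Chernoff bound.\<close>
  define c where "c = 2 * sqrt (x / n)"
  define t where "t = 1015 * (1 + \<eta>) * real d * (1 + sqrt (1 + 2 * real n / (1015 * real d)))
              + 2 * sqrt (real n * x) + (5 / 2 + 32 / \<eta>) * x"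
  have c: "0 < c" using assms(2,10) by (simp add: c_def)
  have int: "integrable M (\<lambda>\<omega>. exp (c * Z \<omega>))"
    using emp_dev_le[OF ne P, of n] c
    by (intro M.integrable_const_bound[of _ "exp (c * n)"]) (simp add: Z_def, measurable)
  have "(\<integral>\<omega>. exp (c * Z \<omega>) \<partial>M) = (\<integral>\<omega>. exp (c * emp_dev P n \<C> \<omega>) \<partial>distr M ?Q ?\<xi>)"
    unfolding Z_def by (rule integral_distr[OF \<xi>_meas, symmetric]) measurable
  also have "\<dots> = (\<integral>\<omega>. exp (c * emp_dev P n \<C> \<omega>) \<partial>?Q)"
    by (simp only: joint)
  also have "\<dots> \<le> exp (c * (10 * sqrt (8 * real n * real d)) + c\<^sup>2 * n / 2)"
    using c assms(2,7,8) space_P by (intro emp_dev_mgf_le P \<C> ne) auto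
  finally have mgf: "(\<integral>\<omega>. exp (c * Z \<omega>) \<partial>M) \<le> exp (c * (10 * sqrt (8 * real n * real d)) + c\<^sup>2 * n / 2)" .
  \<comment> \<open>The first summand of \<open>t\<close> exceeds \<open>sqrt (2030 * n * d)\<close>, which leaves room above the
    chaining bound \<open>sqrt (800 * n * d)\<close>.\<close>
  have t: "10 * sqrt (8 * real n * real d) + 2 * sqrt (real n * x) \<le> t"
  proof -
    define D where "D = 1015 * real d"
    have D: "0 < D" using assms(8) by (simp add: D_def)
    have "10 * sqrt (8 * real n * real d) = sqrt (800 * (real n * real d))"
      using real_sqrt_mult[of 100 "8 * real n * real d"] by simp
    also have "\<dots> \<le> sqrt (D\<^sup>2 * (2 * n / D))"
      using D by (intro real_sqrt_le_mono) (simp add: D_def power2_eq_square)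
    also have "\<dots> = D * sqrt (2 * n / D)" using D unfolding real_sqrt_mult by simp
    also have "\<dots> \<le> D * (1 + sqrt (1 + 2 * n / D))"
      using D by (intro mult_left_mono add_increasing real_sqrt_le_mono) auto
    also have "\<dots> \<le> (1 + \<eta>) * (D * (1 + sqrt (1 + 2 * n / D)))"
      using D assms(9) mult_right_mono[of 1 "1 + \<eta>" "D * (1 + sqrt (1 + 2 * n / D))"] by simp
    finally have "10 * sqrt (8 * real n * real d) \<le> (1 + \<eta>) * (D * (1 + sqrt (1 + 2 * real n / D)))"
      by simp
    moreover have "t = (1 + \<eta>) * (D * (1 + sqrt (1 + 2 * real n / D)))
        + 2 * sqrt (real n * x) + (5 / 2 + 32 / \<eta>) * x"
      by (simp only: t_def D_def mult_ac)
    moreover have "0 \<le> (5 / 2 + 32 / \<eta>) * x" using assms(9,10) by simp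
    ultimately show ?thesis by linarith
  qed
  have "\<P>(\<omega> in M. Z \<omega> \<ge> t) = \<P>(\<omega> in M. exp (c * Z \<omega>) \<ge> exp (c * t))"
    using c by simp
  also have "\<dots> \<le> (\<integral>\<omega>. exp (c * Z \<omega>) \<partial>M) / exp (c * t)"
    by (rule integral_Markov_inequality_measure[OF int sets.top]) auto
  also have "\<dots> \<le> exp (c * (10 * sqrt (8 * real n * real d)) + c\<^sup>2 * n / 2) / exp (c * t)"
    using mgf by (intro divide_right_mono) auto
  also have "\<dots> = exp (c * (10 * sqrt (8 * real n * real d) - t) + c\<^sup>2 * n / 2)"
    by (simp add: algebra_simps flip: exp_diff)
  also have "\<dots> \<le> exp (c * (- (2 * sqrt (real n * x))) + c\<^sup>2 * n / 2)"
    unfolding exp_le_cancel_iff using t c by (intro add_right_mono mult_left_mono) auto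
  also have "c * (- (2 * sqrt (real n * x))) + c\<^sup>2 * n / 2 = - 2 * x"
  proof -
    have "sqrt (x / n) * sqrt (real n * x) = x"
      using assms(2,10) by (simp flip: real_sqrt_mult)
    then have "c * sqrt (real n * x) = 2 * x" by (simp add: c_def)
    moreover have "c\<^sup>2 * n = 4 * x" using assms(2,10) by (simp add: c_def power_mult_distrib)
    moreover have "c * (- (2 * sqrt (real n * x))) = - 2 * (c * sqrt (real n * x))" by simp
    ultimately show ?thesis by linarith
  qed
  also have "exp (- 2 * x) \<le> 2 * exp (- x)"
  proof -
    have "exp (- 2 * x) \<le> exp (- x)" using assms(10) by simp
    then show ?thesis using exp_ge_zero[of "- x"] by linarith
  qed
  finally show ?thesis unfolding Z_eq t_def .
qed

end
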